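(* Let $\mathcal R$ be a ring (with $1$, not necessarily commutative) and let $A$ be a square matrix over $\mathcal R$. Then $\operatorname{cok}(I-tA)$ and the direct limit module of $A$ are isomorphic, both as $\mathcal R[t]$-modules and as $\mathcal R[t,t^{-1}]$-modules. Moreover, for square matrices $A,B$ over $\mathcal R$ the following are equivalent: (1) $A$ and $B$ are shift equivalent over $\mathcal R$; (2) the direct limit $\mathcal R[t]$-modules of $A$ and $B$ are isomorphic; (3) the $\mathcal R[t]$-modules $\operatorname{cok}(I-tA)$ and $\operatorname{cok}(I-tB)$ are isomorphic; (4) the direct limit $\mathcal R[t,t^{-1}]$-modules of $A$ and $B$ are isomorphic; (5) the $\mathcal R[t,t^{-1}]$-modules $\operatorname{cok}(I-tA)$ and $\operatorname{cok}(I-tB)$ are isomorphic.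
   Context: Modules are left modules; $\mathcal R^n$ consists of row vectors, and $t$ is a central indeterminate. $A,B$ (possibly of different sizes) are shift equivalent over $\mathcal R$ if there are matrices $R,S$ over $\mathcal R$ and a positive integer $\ell$ with $A^{\ell}=RS$, $B^{\ell}=SR$, $AR=RB$, $SA=BS$. For $A$ of size $n\times n$, the direct limit group $G_A$ is the direct limit of $\mathcal R^n\to\mathcal R^n\to\cdots$ with every map $v\mapsto vA$: its elements are classes $[(v,m)]$, $v\in\mathcal R^n$, $m\in\mathbb Z_+$, with $[(v,m)]=[(vA,m+1)]$; it is an $\mathcal R$-module by $r[(v,m)]=[(rv,m)]$. The map $\widehat A:[(v,m)]\mapsto[(vA,m)]$ is an $\mathcal R$-module automorphism of $G_A$ with inverse $[(v,m)]\mapsto[(v,m+1)]$. The direct limit $\mathcal R[t,t^{-1}]$-module of $A$ is $G_A$ with $t$ acting by $\widehat A^{-1}$ and $t^{-1}$ acting by $\widehat A$; restricting the action to $\mathcal R[t]$ gives the direct limit $\mathcal R[t]$-module. $\operatorname{cok}(I-tA)=(\mathcal R[t])^n/\{v(I-tA):v\in(\mathcal R[t])^n\}$, an $\mathcal R[t]$-module; the action of $t$ on it is invertible with inverse $[v]\mapsto[vA]$, which makes it an $\mathcal R[t,t^{-1}]$-module. *)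

theory Defs
  imports "Jordan_Normal_Form.Matrix" "HOL-Library.Poly_Mapping" "HOL-Algebra.AbelCoset"
begin

text \<open>
  The coefficient ring is a type of sort \<open>{ring, monoid_mult}\<close>: an associative ring with
  unit, not necessarily commutative. Unlike \<^class>\<open>ring_1\<close> this sort also admits
  the zero ring.

  \<open>nat \<Rightarrow>\<^sub>0 'a\<close> with its convolution product is the polynomial ring in a central
  indeterminate \<open>t\<close>, and \<open>int \<Rightarrow>\<^sub>0 'a\<close> the Laurent polynomial ring;
  \<open>Poly_Mapping.single k r\<close> is \<open>r t\<^sup>k\<close>. The library declares the constant
  \<open>1\<close> on these types only if \<open>0 \<noteq> 1\<close> in \<open>'a\<close>, therefore the unit is written
  \<open>Poly_Mapping.single 0 1\<close> throughout.
\<close>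


section \<open>Left modules\<close>

text \<open>
  The locale \<^locale>\<open>module\<close> of the library requires commutative scalars, so only its
  record type is used; its fields \<^const>\<open>mult\<close> and \<^const>\<open>one\<close> are irrelevant.
  The scalars form a whole type, with unit \<open>e\<close>.
\<close>

locale left_module = abelian_group M
  for e :: "'r::ring" and M :: "('r, 'm, 'x) module_scheme" (structure) +
  assumes smult_closed [simp, intro]: "x \<in> carrier M \<Longrightarrow> r \<odot> x \<in> carrier M"
    and smult_l_distr: "x \<in> carrier M \<Longrightarrow> (r + s) \<odot> x = r \<odot> x \<oplus> s \<odot> x"
    and smult_r_distr:
      "\<lbrakk>x \<in> carrier M; y \<in> carrier M\<rbrakk> \<Longrightarrow> r \<odot> (x \<oplus> y) = r \<odot> x \<oplus> r \<odot> y"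
    and smult_assoc: "x \<in> carrier M \<Longrightarrow> (r * s) \<odot> x = r \<odot> (s \<odot> x)"
    and smult_unit [simp]: "x \<in> carrier M \<Longrightarrow> e \<odot> x = x"

definition module_iso ::
  "('r, 'm, 'x) module_scheme \<Rightarrow> ('r, 'n, 'y) module_scheme \<Rightarrow> ('m \<Rightarrow> 'n) set" where
  "module_iso M N = {f. bij_betw f (carrier M) (carrier N) \<and>
     (\<forall>x\<in>carrier M. \<forall>y\<in>carrier M. f (x \<oplus>\<^bsub>M\<^esub> y) = f x \<oplus>\<^bsub>N\<^esub> f y) \<and>
     (\<forall>r. \<forall>x\<in>carrier M. f (r \<odot>\<^bsub>M\<^esub> x) = r \<odot>\<^bsub>N\<^esub> f x)}"

definition module_isomorphic ::
  "('r, 'm, 'x) module_scheme \<Rightarrow> ('r, 'n, 'y) module_scheme \<Rightarrow> bool"  (infix \<open>\<cong>\<^sub>m\<close> 60) where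
  "M \<cong>\<^sub>m N \<longleftrightarrow> module_iso M N \<noteq> {}"

definition restrict_scalars ::
  "('s \<Rightarrow> 'r) \<Rightarrow> ('r, 'm, 'x) module_scheme \<Rightarrow> ('s, 'm) module" where
  "restrict_scalars f M =
     \<lparr>carrier = carrier M, mult = mult M, one = one M, zero = zero M, add = add M,
      smult = (\<lambda>s x. f s \<odot>\<^bsub>M\<^esub> x)\<rparr>"

definition free_module :: "nat \<Rightarrow> ('r::ring, 'r vec) module" where
  "free_module n =
     \<lparr>carrier = carrier_vec n, mult = undefined, one = undefined, zero = 0\<^sub>v n, add = (+),
      smult = (\<cdot>\<^sub>v)\<rparr>"

definition quotient_module ::
  "('r, 'm, 'x) module_scheme \<Rightarrow> 'm set \<Rightarrow> ('r, 'm set) module" where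
  "quotient_module M N =
     \<lparr>carrier = a_rcosets\<^bsub>M\<^esub> N, mult = undefined, one = undefined, zero = N, add = set_add M,
      smult = (\<lambda>r X. \<Union>x\<in>X. N +>\<^bsub>M\<^esub> (r \<odot>\<^bsub>M\<^esub> x))\<rparr>"

text \<open>
  For an automorphism \<open>T\<close> with inverse \<open>U\<close> of a module \<open>M\<close> over the coefficient ring, the
  Laurent polynomial module with underlying group \<open>M\<close> on which \<open>t\<close> acts by \<open>T\<close>
  and \<open>t\<^sup>-\<^sup>1\<close> by \<open>U\<close>.
\<close>

definition int_iterate :: "('m \<Rightarrow> 'm) \<Rightarrow> ('m \<Rightarrow> 'm) \<Rightarrow> int \<Rightarrow> 'm \<Rightarrow> 'm" where
  "int_iterate T U k = (if 0 \<le> k then T ^^ nat k else U ^^ nat (- k))"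

definition laurent_module ::
  "('a::ring, 'm, 'x) module_scheme \<Rightarrow> ('m \<Rightarrow> 'm) \<Rightarrow> ('m \<Rightarrow> 'm) \<Rightarrow> (int \<Rightarrow>\<^sub>0 'a, 'm) module" where
  "laurent_module M T U =
     \<lparr>carrier = carrier M, mult = mult M, one = one M, zero = zero M, add = add M,
      smult = (\<lambda>q x. \<Oplus>\<^bsub>M\<^esub>k\<in>Poly_Mapping.keys q.
                 Poly_Mapping.lookup q k \<odot>\<^bsub>M\<^esub> int_iterate T U k x)\<rparr>"

definition poly_to_laurent :: "(nat \<Rightarrow>\<^sub>0 'a::ring) \<Rightarrow> (int \<Rightarrow>\<^sub>0 'a)" where
  "poly_to_laurent p =
     (\<Sum>k\<in>Poly_Mapping.keys p. Poly_Mapping.single (int k) (Poly_Mapping.lookup p k))"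


section \<open>Matrices and shift equivalence\<close>

definition vec_mult_mat :: "'a::semiring_0 vec \<Rightarrow> 'a mat \<Rightarrow> 'a vec"  (infixl \<open>\<^sub>v*\<close> 70) where
  "v \<^sub>v* A = vec (dim_col A) (\<lambda>j. v \<bullet> col A j)"

text \<open>The library's \<^const>\<open>pow_mat\<close> excludes the zero ring.\<close>

primrec mat_power :: "'a::{ring, monoid_mult} mat \<Rightarrow> nat \<Rightarrow> 'a mat" where
  "mat_power A 0 = 1\<^sub>m (dim_row A)"
| "mat_power A (Suc l) = mat_power A l * A"

definition shift_equivalent :: "'a::{ring, monoid_mult} mat \<Rightarrow> 'a mat \<Rightarrow> bool" where
  "shift_equivalent A B \<longleftrightarrow>
     (\<exists>l>0. \<exists>R\<in>carrier_mat (dim_row A) (dim_row B). \<exists>S\<in>carrier_mat (dim_row B) (dim_row A).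
        mat_power A l = R * S \<and> mat_power B l = S * R \<and> A * R = R * B \<and> S * A = B * S)"


section \<open>The direct limit modules\<close>

text \<open>
  Elements of the direct limit are classes of pairs \<open>(v, m)\<close>, where \<open>v\<close> sits in the
  \<open>m\<close>-th copy of the row space; two pairs are identified if their images in some later
  copy agree.
\<close>

definition dirlim_rel :: "'a::ring mat \<Rightarrow> (('a vec \<times> nat) \<times> ('a vec \<times> nat)) set" where
  "dirlim_rel A = {((v, m), (w, k)). v \<in> carrier_vec (dim_row A) \<and> w \<in> carrier_vec (dim_row A) \<and>
     (\<exists>p q. m + p = k + q \<and> ((\<lambda>u. u \<^sub>v* A) ^^ p) v = ((\<lambda>u. u \<^sub>v* A) ^^ q) w)}"

definition dirlim_class :: "'a::ring mat \<Rightarrow> 'a vec \<Rightarrow> nat \<Rightarrow> ('a vec \<times> nat) set" where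
  "dirlim_class A v m = dirlim_rel A `` {(v, m)}"

definition dirlim :: "'a::ring mat \<Rightarrow> ('a, ('a vec \<times> nat) set) module" where
  "dirlim A =
     \<lparr>carrier = (carrier_vec (dim_row A) \<times> UNIV) // dirlim_rel A,
      mult = undefined, one = undefined,
      zero = dirlim_class A (0\<^sub>v (dim_row A)) 0,
      add = (\<lambda>X Y. \<Union>(v, m)\<in>X. \<Union>(w, k)\<in>Y.
        dirlim_class A (((\<lambda>u. u \<^sub>v* A) ^^ k) v + ((\<lambda>u. u \<^sub>v* A) ^^ m) w) (m + k)),
      smult = (\<lambda>r X. \<Union>(v, m)\<in>X. dirlim_class A (r \<cdot>\<^sub>v v) m)\<rparr>"

definition dirlim_hat :: "'a::ring mat \<Rightarrow> ('a vec \<times> nat) set \<Rightarrow> ('a vec \<times> nat) set" where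
  "dirlim_hat A X = (\<Union>(v, m)\<in>X. dirlim_class A (v \<^sub>v* A) m)"

definition dirlim_hat_inv :: "'a::ring mat \<Rightarrow> ('a vec \<times> nat) set \<Rightarrow> ('a vec \<times> nat) set" where
  "dirlim_hat_inv A X = (\<Union>(v, m)\<in>X. dirlim_class A v (Suc m))"

definition dirlim_laurent ::
  "'a::{ring, monoid_mult} mat \<Rightarrow> (int \<Rightarrow>\<^sub>0 'a, ('a vec \<times> nat) set) module" where
  "dirlim_laurent A = laurent_module (dirlim A) (dirlim_hat_inv A) (dirlim_hat A)"

definition dirlim_poly ::
  "'a::{ring, monoid_mult} mat \<Rightarrow> (nat \<Rightarrow>\<^sub>0 'a, ('a vec \<times> nat) set) module" where
  "dirlim_poly A = restrict_scalars poly_to_laurent (dirlim_laurent A)"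


section \<open>The cokernel modules\<close>

definition I_minus_tA :: "'a::{ring, monoid_mult} mat \<Rightarrow> (nat \<Rightarrow>\<^sub>0 'a) mat" where
  "I_minus_tA A =
     map_mat (Poly_Mapping.single 0) (1\<^sub>m (dim_row A)) - map_mat (Poly_Mapping.single 1) A"

definition cok_image :: "'a::{ring, monoid_mult} mat \<Rightarrow> (nat \<Rightarrow>\<^sub>0 'a) vec set" where
  "cok_image A = (\<lambda>v. v \<^sub>v* I_minus_tA A) ` carrier_vec (dim_row A)"

definition cok_poly ::
  "'a::{ring, monoid_mult} mat \<Rightarrow> (nat \<Rightarrow>\<^sub>0 'a, (nat \<Rightarrow>\<^sub>0 'a) vec set) module" where
  "cok_poly A = quotient_module (free_module (dim_row A)) (cok_image A)"

definition cok_t ::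
  "'a::{ring, monoid_mult} mat \<Rightarrow> (nat \<Rightarrow>\<^sub>0 'a) vec set \<Rightarrow> (nat \<Rightarrow>\<^sub>0 'a) vec set" where
  "cok_t A X = Poly_Mapping.single 1 1 \<odot>\<^bsub>cok_poly A\<^esub> X"

definition cok_t_inv ::
  "'a::{ring, monoid_mult} mat \<Rightarrow> (nat \<Rightarrow>\<^sub>0 'a) vec set \<Rightarrow> (nat \<Rightarrow>\<^sub>0 'a) vec set" where
  "cok_t_inv A X =
     (\<Union>v\<in>X. cok_image A +>\<^bsub>free_module (dim_row A)\<^esub> (v \<^sub>v* map_mat (Poly_Mapping.single 0) A))"

definition cok_laurent ::
  "'a::{ring, monoid_mult} mat \<Rightarrow> (int \<Rightarrow>\<^sub>0 'a, (nat \<Rightarrow>\<^sub>0 'a) vec set) module" where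
  "cok_laurent A =
     laurent_module (restrict_scalars (Poly_Mapping.single 0) (cok_poly A)) (cok_t A) (cok_t_inv A)"

section \<open>Consistency of the definitions\<close>

text \<open>
  All four modules are left modules over their Laurent polynomial or polynomial ring, the
  operations on classes do not depend on representatives, and the given pairs of maps are
  mutually inverse automorphisms. Restricting \<open>cok_laurent A\<close> to polynomials gives
  \<open>cok_poly A\<close> back.
\<close>

subsection \<open>Polynomials\<close>

lemma poly_mapping_sum_single:
  fixes p :: "'k \<Rightarrow>\<^sub>0 'a::comm_monoid_add"
  shows "p = (\<Sum>k\<in>Poly_Mapping.keys p. Poly_Mapping.single k (Poly_Mapping.lookup p k))"
  by (rule poly_mapping_eqI)
    (auto simp: lookup_sum lookup_single when_def sum.delta not_in_keys_iff_lookup_eq_zero)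

lemma poly_mapping_additive_induct [case_names zero single add]:
  fixes p :: "'k \<Rightarrow>\<^sub>0 'a::comm_monoid_add"
  assumes "P 0" and "\<And>k a. P (Poly_Mapping.single k a)" and "\<And>p q. P p \<Longrightarrow> P q \<Longrightarrow> P (p + q)"
  shows "P p"
proof -
  have "P (\<Sum>k\<in>K. Poly_Mapping.single k (Poly_Mapping.lookup p k))" if "finite K" for K
    using that by (induction K rule: finite_induct) (auto intro: assms)
  then show ?thesis
    using poly_mapping_sum_single[of p] by (metis finite_keys)
qed

lemma mult_single_unit [simp]:
  fixes p :: "'k::monoid_add \<Rightarrow>\<^sub>0 'a::{ring, monoid_mult}"
  shows "Poly_Mapping.single 0 1 * p = p" and "p * Poly_Mapping.single 0 1 = p"
  by (induction p rule: poly_mapping_additive_induct; simp add: mult_single algebra_simps)+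

lemma single_mult_commute:
  fixes p :: "'k::comm_monoid_add \<Rightarrow>\<^sub>0 'a::{ring, monoid_mult}"
  shows "p * Poly_Mapping.single k 1 = Poly_Mapping.single k 1 * p"
  by (induction p rule: poly_mapping_additive_induct) (simp_all add: mult_single algebra_simps)

lemma poly_to_laurent_superset:
  assumes "finite K" "Poly_Mapping.keys p \<subseteq> K"
  shows "poly_to_laurent p = (\<Sum>k\<in>K. Poly_Mapping.single (int k) (Poly_Mapping.lookup p k))"
  unfolding poly_to_laurent_def using assms
  by (intro sum.mono_neutral_left) (auto simp: not_in_keys_iff_lookup_eq_zero)

lemma poly_to_laurent_single [simp]:
  "poly_to_laurent (Poly_Mapping.single k a) = Poly_Mapping.single (int k) a"
  using poly_to_laurent_superset[of "{k}" "Poly_Mapping.single k a"] by auto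

lemma poly_to_laurent_add: "poly_to_laurent (p + q) = poly_to_laurent p + poly_to_laurent q"
proof -
  let ?K = "Poly_Mapping.keys p \<union> Poly_Mapping.keys q"
  have "Poly_Mapping.keys (p + q) \<subseteq> ?K"
    by (rule Poly_Mapping.keys_add)
  then show ?thesis
    by (simp add: poly_to_laurent_superset[of ?K] lookup_add single_add sum.distrib)
qed

lemma poly_to_laurent_zero [simp]: "poly_to_laurent 0 = 0"
  by (simp add: poly_to_laurent_def)

lemma poly_to_laurent_mult: "poly_to_laurent (p * q) = poly_to_laurent p * poly_to_laurent q"
proof (induction p rule: poly_mapping_additive_induct)
  case (single k a)
  show ?case
    by (induction q rule: poly_mapping_additive_induct)
      (simp_all add: mult_single poly_to_laurent_add algebra_simps)
qed (simp_all add: poly_to_laurent_add algebra_simps)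

subsection \<open>Row vectors\<close>

lemma dim_vec_mult_mat [simp]: "dim_vec (v \<^sub>v* A) = dim_col A"
  by (simp add: vec_mult_mat_def)

lemma vec_mult_mat_closed [simp]: "A \<in> carrier_mat n m \<Longrightarrow> v \<^sub>v* A \<in> carrier_vec m"
  by (simp add: carrier_vecI)

lemma vec_mult_mat_index:
  "A \<in> carrier_mat n m \<Longrightarrow> j < m \<Longrightarrow> (v \<^sub>v* A) $ j = (\<Sum>i<n. v $ i * A $$ (i, j))"
  by (auto simp: vec_mult_mat_def scalar_prod_def atLeast0LessThan)

lemma vec_mult_mat_add:
  assumes "A \<in> carrier_mat n m" "v \<in> carrier_vec n" "w \<in> carrier_vec n"
  shows "(v + w) \<^sub>v* A = v \<^sub>v* A + w \<^sub>v* A"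
  using assms by (auto simp: vec_mult_mat_def add_scalar_prod_distrib[of _ n])

lemma vec_mult_mat_smult:
  fixes A :: "'a::ring mat"
  assumes "A \<in> carrier_mat n m" "v \<in> carrier_vec n"
  shows "(r \<cdot>\<^sub>v v) \<^sub>v* A = r \<cdot>\<^sub>v (v \<^sub>v* A)"
  using assms
  by (intro eq_vecI) (auto simp: vec_mult_mat_index sum_distrib_left mult.assoc intro!: sum.cong)

lemma vec_mult_mat_zero:
  "A \<in> carrier_mat n m \<Longrightarrow> 0\<^sub>v n \<^sub>v* A = 0\<^sub>v m"
  by (intro eq_vecI) (auto simp: vec_mult_mat_index)

lemma vec_mult_I_minus_tA:
  fixes A :: "'a::{ring, monoid_mult} mat"
  assumes A: "A \<in> carrier_mat n n" and v: "v \<in> carrier_vec n"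
  shows "v \<^sub>v* I_minus_tA A =
    v - Poly_Mapping.single 1 1 \<cdot>\<^sub>v (v \<^sub>v* map_mat (Poly_Mapping.single 0) A)"
proof (rule eq_vecI)
  have I: "I_minus_tA A \<in> carrier_mat n n"
    using A by (auto simp: I_minus_tA_def)
  have C: "map_mat (Poly_Mapping.single 0) A \<in> carrier_mat n n"
    using A by simp
  fix j
  assume "j < dim_vec (v - Poly_Mapping.single 1 1 \<cdot>\<^sub>v (v \<^sub>v* map_mat (Poly_Mapping.single 0) A))"
  then have j: "j < n"
    using A by simp
  have t: "v $ i * Poly_Mapping.single 1 a = Poly_Mapping.single 1 1 * (v $ i * Poly_Mapping.single 0 a)"
    for i a
    by (simp add: mult.assoc[symmetric] single_mult_commute[symmetric])
      (simp add: mult.assoc mult_single)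
  have "(v \<^sub>v* I_minus_tA A) $ j =
    (\<Sum>i<n. v $ i * (Poly_Mapping.single 0 (if i = j then 1 else 0) - Poly_Mapping.single 1 (A $$ (i, j))))"
    unfolding vec_mult_mat_index[OF I j]
    using A j by (intro sum.cong) (auto simp: I_minus_tA_def)
  also have "\<dots> = (\<Sum>i<n. v $ i * (if i = j then Poly_Mapping.single 0 1 else 0)) -
      (\<Sum>i<n. v $ i * Poly_Mapping.single 1 (A $$ (i, j)))"
    by (simp add: right_diff_distrib sum_subtractf if_distrib[of "Poly_Mapping.single 0"] cong: if_cong)
  also have "\<dots> = v $ j - Poly_Mapping.single 1 1 * (\<Sum>i<n. v $ i * Poly_Mapping.single 0 (A $$ (i, j)))"
    using j by (simp add: t sum_distrib_left if_distrib[of "(*) _"] del: One_nat_def cong: if_cong)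
  also have "(\<Sum>i<n. v $ i * Poly_Mapping.single 0 (A $$ (i, j))) =
      (v \<^sub>v* map_mat (Poly_Mapping.single 0) A) $ j"
    unfolding vec_mult_mat_index[OF C j] using A j by (intro sum.cong) auto
  finally show "(v \<^sub>v* I_minus_tA A) $ j =
    (v - Poly_Mapping.single 1 1 \<cdot>\<^sub>v (v \<^sub>v* map_mat (Poly_Mapping.single 0) A)) $ j"
    using A v j by simp
qed (use A in \<open>auto simp: I_minus_tA_def\<close>)

subsection \<open>Modules\<close>

lemma abelian_group_of_comm_group:
  assumes "comm_group G" "carrier M = carrier G" "add M = mult G" "zero M = one G"
  shows "abelian_group M"
proof -
  interpret comm_group G by fact
  show ?thesis
    by (rule abelian_groupI)
      (auto simp: assms m_assoc m_lcomm intro: m_comm l_inv_ex)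
qed

lemma left_module_restrict_scalars:
  assumes "left_module e M"
    and "\<And>r s. f (r + s) = f r + f s" "\<And>r s. f (r * s) = f r * f s" "f e' = e"
  shows "left_module e' (restrict_scalars f M)"
proof -
  interpret left_module e M by fact
  have 1: "abelian_group (restrict_scalars f M)"
    by (rule abelian_group_of_comm_group[OF a_comm_group]) (simp_all add: restrict_scalars_def)
  show ?thesis
    by (intro left_module.intro 1 left_module_axioms.intro)
      (auto simp: restrict_scalars_def assms smult_l_distr smult_r_distr smult_assoc)
qed

lemma left_module_free_module: 
  "left_module 1 (free_module n :: ('a::{ring, monoid_mult}, 'a vec) module)"
  "left_module (Poly_Mapping.single 0 1)
     (free_module n :: ('k::monoid_add \<Rightarrow>\<^sub>0 'a::{ring, monoid_mult}, ('k \<Rightarrow>\<^sub>0 'a) vec) module)"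
proof -
  have *: "left_module e (free_module n)" if "\<And>x. e * x = x" for e :: "'r::ring"
  proof (intro left_module.intro left_module_axioms.intro)
    show "abelian_group (free_module n :: ('r, 'r vec) module)"
      by (rule abelian_group_of_comm_group[OF comm_group_vec])
        (simp_all add: free_module_def monoid_vec_def)
  qed (auto simp: free_module_def that add_smult_distrib_vec smult_add_distrib_vec[of _ n]
        smult_vec_def mult.assoc algebra_simps intro!: eq_vecI)
  show "left_module 1 (free_module n :: ('a::{ring, monoid_mult}, 'a vec) module)"
    and "left_module (Poly_Mapping.single 0 1)
     (free_module n :: ('k::monoid_add \<Rightarrow>\<^sub>0 'a::{ring, monoid_mult}, ('k \<Rightarrow>\<^sub>0 'a) vec) module)"
    by (rule *; simp)+
qed

locale submodule_of = left_module +
  fixes N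
  assumes additive_subgroup: "additive_subgroup N M"
    and smult_mem: "x \<in> N \<Longrightarrow> r \<odot> x \<in> N"
begin

sublocale N: abelian_subgroup N M
  by (rule abelian_subgroupI3) (fact additive_subgroup abelian_group_axioms)+

lemma coset_eq_iff:
  assumes "x \<in> carrier M" "y \<in> carrier M"
  shows "N +> x = N +> y \<longleftrightarrow> x \<ominus> y \<in> N"
  by (metis N.a_rcos_module N.a_repr_independence' N.a_repr_independenceD a_minus_def assms)

lemma UN_coset:
  assumes x: "x \<in> carrier M" and "\<And>y. y \<in> carrier M \<Longrightarrow> f y \<in> carrier M"
    and "\<And>y z. \<lbrakk>y \<in> carrier M; z \<in> carrier M; y \<ominus> z \<in> N\<rbrakk> \<Longrightarrow> f y \<ominus> f z \<in> N"
  shows "(\<Union>y\<in>N +> x. N +> f y) = N +> f x"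
proof -
  have "N +> f y = N +> f x" if "y \<in> N +> x" for y
  proof -
    have "y \<in> carrier M"
      using that x N.a_elemrcos_carrier by blast
    moreover have "N +> y = N +> x"
      using N.a_repr_independence'[OF that x] by simp
    ultimately show ?thesis
      using assms by (auto simp: coset_eq_iff)
  qed
  then show ?thesis
    using N.a_rcos_self[OF x] by blast
qed

lemma quotient_smult:
  assumes "x \<in> carrier M"
  shows "r \<odot>\<^bsub>quotient_module M N\<^esub> (N +> x) = N +> (r \<odot> x)"
proof -
  have "r \<odot> (y \<ominus> z) = r \<odot> y \<ominus> r \<odot> z" if "y \<in> carrier M" "z \<in> carrier M" for y z
  proof -
    have "r \<odot> (y \<ominus> z) \<oplus> r \<odot> z = r \<odot> (y \<ominus> z \<oplus> z)"
      using that by (simp add: smult_r_distr)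
    also have "y \<ominus> z \<oplus> z = y"
      using that by (simp add: a_minus_def a_assoc l_neg)
    finally show ?thesis
      using that by (metis smult_closed minus_closed a_minus_def a_assoc r_neg r_zero a_inv_closed)
  qed
  then have "r \<odot> y \<ominus> r \<odot> z \<in> N" if "y \<in> carrier M" "z \<in> carrier M" "y \<ominus> z \<in> N" for y z
    using that smult_mem by metis
  then show ?thesis
    unfolding quotient_module_def using UN_coset[of x "\<lambda>y. r \<odot> y"] assms by simp
qed

lemma quotient_carrier: "carrier (quotient_module M N) = (\<lambda>x. N +> x) ` carrier M"
  by (auto simp: quotient_module_def A_RCOSETS_def')

lemma quotient_add:
  "\<lbrakk>x \<in> carrier M; y \<in> carrier M\<rbrakk> \<Longrightarrow>
    (N +> x) \<oplus>\<^bsub>quotient_module M N\<^esub> (N +> y) = N +> (x \<oplus> y)"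
  by (simp add: quotient_module_def N.a_rcos_sum)

lemma left_module_quotient: "left_module e (quotient_module M N)"
proof (intro left_module.intro left_module_axioms.intro)
  show "abelian_group (quotient_module M N)"
    by (rule abelian_group_of_comm_group[OF N.a_factorgroup_is_comm_group])
      (simp_all add: quotient_module_def A_FactGroup_def')
qed (auto simp: quotient_carrier quotient_smult quotient_add smult_l_distr smult_r_distr smult_assoc)

end

subsection \<open>Laurent modules\<close>

locale module_automorphism = left_module 1 M
  for M :: "('a::{ring, monoid_mult}, 'm, 'x) module_scheme" (structure) +
  fixes T U :: "'m \<Rightarrow> 'm"
  assumes T_closed [simp]: "x \<in> carrier M \<Longrightarrow> T x \<in> carrier M"
    and U_closed [simp]: "x \<in> carrier M \<Longrightarrow> U x \<in> carrier M"
    and T_U [simp]: "x \<in> carrier M \<Longrightarrow> T (U x) = x"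
    and U_T [simp]: "x \<in> carrier M \<Longrightarrow> U (T x) = x"
    and T_add: "\<lbrakk>x \<in> carrier M; y \<in> carrier M\<rbrakk> \<Longrightarrow> T (x \<oplus> y) = T x \<oplus> T y"
    and T_smult: "x \<in> carrier M \<Longrightarrow> T (r \<odot> x) = r \<odot> T x"
begin

lemma U_add: "\<lbrakk>x \<in> carrier M; y \<in> carrier M\<rbrakk> \<Longrightarrow> U (x \<oplus> y) = U x \<oplus> U y"
  using U_T[of "U x \<oplus> U y"] by (simp add: T_add)

lemma U_smult: "x \<in> carrier M \<Longrightarrow> U (r \<odot> x) = r \<odot> U x"
  using U_T[of "r \<odot> U x"] by (simp add: T_smult)

lemma zero_smult [simp]: "x \<in> carrier M \<Longrightarrow> 0 \<odot> x = \<zero>"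
  using smult_l_distr[of x 0 0] by simp

lemma funpow_T:
  assumes "x \<in> carrier M"
  shows "(T ^^ i) x \<in> carrier M" "(U ^^ i) x \<in> carrier M"
    and "(T ^^ i) (r \<odot> x) = r \<odot> (T ^^ i) x" "(U ^^ i) (r \<odot> x) = r \<odot> (U ^^ i) x"
    and "y \<in> carrier M \<Longrightarrow> (T ^^ i) (x \<oplus> y) = (T ^^ i) x \<oplus> (T ^^ i) y"
    and "y \<in> carrier M \<Longrightarrow> (U ^^ i) (x \<oplus> y) = (U ^^ i) x \<oplus> (U ^^ i) y"
proof -
  have T: "(T ^^ i) x \<in> carrier M" and U: "(U ^^ i) x \<in> carrier M"
    if "x \<in> carrier M" for x i
    by (induction i) (use that in auto)
  show "(T ^^ i) x \<in> carrier M" "(U ^^ i) x \<in> carrier M"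
    by (simp_all add: T U assms)
  show "(T ^^ i) (r \<odot> x) = r \<odot> (T ^^ i) x" "(U ^^ i) (r \<odot> x) = r \<odot> (U ^^ i) x"
    by (induction i) (auto simp: T U T_smult U_smult assms)
  show "y \<in> carrier M \<Longrightarrow> (T ^^ i) (x \<oplus> y) = (T ^^ i) x \<oplus> (T ^^ i) y"
    "y \<in> carrier M \<Longrightarrow> (U ^^ i) (x \<oplus> y) = (U ^^ i) x \<oplus> (U ^^ i) y"
    by (induction i) (auto simp: T U T_add U_add assms)
qed

lemma int_iterate_closed [simp]: "x \<in> carrier M \<Longrightarrow> int_iterate T U k x \<in> carrier M"
  by (simp add: int_iterate_def funpow_T)

lemma int_iterate_smult:
  "x \<in> carrier M \<Longrightarrow> int_iterate T U k (r \<odot> x) = r \<odot> int_iterate T U k x"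
  by (simp add: int_iterate_def funpow_T)

lemma int_iterate_add:
  "\<lbrakk>x \<in> carrier M; y \<in> carrier M\<rbrakk> \<Longrightarrow>
    int_iterate T U k (x \<oplus> y) = int_iterate T U k x \<oplus> int_iterate T U k y"
  by (simp add: int_iterate_def funpow_T)

lemma int_iterate_0 [simp]: "int_iterate T U 0 x = x"
  by (simp add: int_iterate_def)

lemma int_iterate_Suc:
  assumes "x \<in> carrier M"
  shows "int_iterate T U (k + 1) x = T (int_iterate T U k x)"
proof (cases "0 \<le> k")
  case True
  then show ?thesis
    by (simp add: int_iterate_def nat_add_distrib)
next
  case False
  then have "nat (- k) = Suc (nat (- (k + 1)))"
    by simp
  then show ?thesis
    using False assms by (auto simp: int_iterate_def funpow_T)
qed

lemma int_iterate_pred: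
  assumes "x \<in> carrier M"
  shows "int_iterate T U (k - 1) x = U (int_iterate T U k x)"
  using int_iterate_Suc[OF assms, of "k - 1"] assms by simp

lemma int_iterate_plus:
  assumes x: "x \<in> carrier M"
  shows "int_iterate T U (k + l) x = int_iterate T U k (int_iterate T U l x)"
proof (induction k rule: int_induct[where k = 0])
  case base
  then show ?case
    by simp
next
  case (step1 k)
  have "int_iterate T U (k + 1 + l) x = int_iterate T U (k + l + 1) x"
    by (simp add: ac_simps)
  then show ?case
    using step1 x by (simp add: int_iterate_Suc)
next
  case (step2 k)
  have "int_iterate T U (k - 1 + l) x = int_iterate T U (k + l - 1) x"
    by (simp add: algebra_simps)
  then show ?case
    using step2 x by (simp add: int_iterate_pred)
qed

abbreviation act :: "(int \<Rightarrow>\<^sub>0 'a) \<Rightarrow> 'm \<Rightarrow> 'm" where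
  "act q x \<equiv> q \<odot>\<^bsub>laurent_module M T U\<^esub> x"

lemma act_superset:
  assumes "finite K" "Poly_Mapping.keys q \<subseteq> K" "x \<in> carrier M"
  shows "act q x = (\<Oplus>k\<in>K. Poly_Mapping.lookup q k \<odot> int_iterate T U k x)"
  unfolding laurent_module_def using assms
  by (simp, intro add.finprod_mono_neutral_cong_left)
    (auto simp: not_in_keys_iff_lookup_eq_zero)

lemma act_closed [simp]: "x \<in> carrier M \<Longrightarrow> act q x \<in> carrier M"
  by (auto simp: laurent_module_def intro!: finsum_closed)

lemma act_0 [simp]: "act 0 x = \<zero>"
  by (simp add: laurent_module_def)

lemma act_single:
  assumes "x \<in> carrier M"
  shows "act (Poly_Mapping.single k r) x = r \<odot> int_iterate T U k x"
  using assms act_superset[of "{k}" "Poly_Mapping.single k r" x] by auto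

lemma act_plus:
  assumes x: "x \<in> carrier M"
  shows "act (p + q) x = act p x \<oplus> act q x"
proof -
  let ?K = "Poly_Mapping.keys p \<union> Poly_Mapping.keys q"
  have "Poly_Mapping.keys (p + q) \<subseteq> ?K"
    by (rule Poly_Mapping.keys_add)
  then show ?thesis
    using x by (simp add: act_superset[of ?K] lookup_add smult_l_distr finsum_addf)
qed

lemma act_add:
  assumes "x \<in> carrier M" "y \<in> carrier M"
  shows "act q (x \<oplus> y) = act q x \<oplus> act q y"
  using assms unfolding laurent_module_def
  by (simp add: int_iterate_add smult_r_distr finsum_addf)

lemma act_zero [simp]: "act q \<zero> = \<zero>"
  using act_add[of \<zero> \<zero> q] by simp

lemma act_mult:
  assumes x: "x \<in> carrier M"
  shows "act (p * q) x = act p (act q x)"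
proof (induction p rule: poly_mapping_additive_induct)
  case (single k a)
  show ?case
  proof (induction q rule: poly_mapping_additive_induct)
    case (single l b)
    show ?case
      using x by (simp add: mult_single act_single int_iterate_plus int_iterate_smult smult_assoc)
  qed (use x in \<open>simp_all add: distrib_left act_plus act_add\<close>)
qed (use x in \<open>simp_all add: distrib_right act_plus\<close>)

lemma left_module_laurent_module: "left_module (Poly_Mapping.single 0 1) (laurent_module M T U)"
proof (intro left_module.intro left_module_axioms.intro)
  show "abelian_group (laurent_module M T U)"
    by (rule abelian_group_of_comm_group[OF a_comm_group]) (simp_all add: laurent_module_def)
  fix x y r s
  assume "x \<in> carrier (laurent_module M T U)"
  then have x: "x \<in> carrier M"
    by (simp add: laurent_module_def)
  show "act (r * s) x = act r (act s x)"
    using x by (rule act_mult)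
  show "act r x \<in> carrier (laurent_module M T U)"
    using x act_closed[of x r] by (simp add: laurent_module_def)
  show "act (r + s) x = act r x \<oplus>\<^bsub>laurent_module M T U\<^esub> act s x"
    using act_plus[OF x, of r s] by (simp add: laurent_module_def)
  show "act (Poly_Mapping.single 0 1) x = x"
    using x by (simp add: act_single)
  assume "y \<in> carrier (laurent_module M T U)"
  then have "y \<in> carrier M"
    by (simp add: laurent_module_def)
  then show "act r (x \<oplus>\<^bsub>laurent_module M T U\<^esub> y) =
      act r x \<oplus>\<^bsub>laurent_module M T U\<^esub> act r y"
    using act_add[OF x, of y r] by (simp add: laurent_module_def)
qed

end

subsection \<open>Cokernels\<close>

lemma free_module_simps [simp]:
  "carrier (free_module n) = carrier_vec n" "add (free_module n) = (+)"
  "zero (free_module n) = 0\<^sub>v n" "smult (free_module n) = (\<cdot>\<^sub>v)"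
  by (simp_all add: free_module_def)

lemma free_module_minus:
  fixes x y :: "('k::monoid_add \<Rightarrow>\<^sub>0 'a::{ring, monoid_mult}) vec"
  assumes "x \<in> carrier_vec n" "y \<in> carrier_vec n"
  shows "x \<ominus>\<^bsub>free_module n\<^esub> y = x - y"
proof -
  interpret left_module "Poly_Mapping.single 0 1"
    "free_module n :: (('k \<Rightarrow>\<^sub>0 'a), ('k \<Rightarrow>\<^sub>0 'a) vec) module"
    by (rule left_module_free_module)
  have "\<ominus>\<^bsub>free_module n\<^esub> y = - y"
    using minus_equality[of "- y" y] assms by (simp add: uminus_l_inv_vec)
  then show ?thesis
    using assms by (simp add: a_minus_def minus_add_uminus_vec[of _ n])
qed

context
  fixes A :: "'a::{ring, monoid_mult} mat" and n :: nat
  assumes A: "A \<in> carrier_mat n n"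
begin

private abbreviation "C \<equiv> map_mat (Poly_Mapping.single 0) A :: (nat \<Rightarrow>\<^sub>0 'a) mat"
private abbreviation "F \<equiv> free_module n :: (nat \<Rightarrow>\<^sub>0 'a, (nat \<Rightarrow>\<^sub>0 'a) vec) module"
private abbreviation "t \<equiv> Poly_Mapping.single 1 1 :: nat \<Rightarrow>\<^sub>0 'a"

private lemma dims: "dim_row A = n" "C \<in> carrier_mat n n" "I_minus_tA A \<in> carrier_mat n n"
  using A by (auto simp: I_minus_tA_def)

lemma submodule_of_cok_image:
  "submodule_of (Poly_Mapping.single 0 1) F (cok_image A)"
proof -
  interpret left_module "Poly_Mapping.single 0 1" F
    by (rule left_module_free_module)
  have *: "additive_subgroup (cok_image A) F"
  proof (intro additive_subgroupI add.subgroupI)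
    fix a assume "a \<in> cok_image A"
    then obtain v where v: "v \<in> carrier_vec n" "a = v \<^sub>v* I_minus_tA A"
      by (auto simp: cok_image_def dims)
    have "\<ominus>\<^bsub>F\<^esub> a = (- v) \<^sub>v* I_minus_tA A"
      using minus_equality[of "(- v) \<^sub>v* I_minus_tA A" a] v dims(3)
      by (simp add: vec_mult_mat_add[of _ n n, symmetric] uminus_l_inv_vec vec_mult_mat_zero)
    then show "\<ominus>\<^bsub>F\<^esub> a \<in> cok_image A"
      using v by (auto simp: cok_image_def dims)
    fix b assume "b \<in> cok_image A"
    then obtain w where w: "w \<in> carrier_vec n" "b = w \<^sub>v* I_minus_tA A"
      by (auto simp: cok_image_def dims)
    show "a \<oplus>\<^bsub>F\<^esub> b \<in> cok_image A"
      using v w dims(3) by (auto simp: cok_image_def dims(1) vec_mult_mat_add[of _ n n, symmetric])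
  qed (use dims zero_carrier_vec[of n] in \<open>auto simp: cok_image_def simp del: zero_carrier_vec\<close>)
  show ?thesis
  proof (intro submodule_of.intro submodule_of_axioms.intro * left_module_free_module)
    fix x r assume "x \<in> cok_image A"
    then show "r \<odot>\<^bsub>F\<^esub> x \<in> cok_image A"
      using dims(3) by (auto simp: cok_image_def dims(1) vec_mult_mat_smult[of _ n n, symmetric])
  qed
qed

interpretation submodule_of "Poly_Mapping.single 0 1" F "cok_image A"
  by (rule submodule_of_cok_image)

lemma left_module_cok_poly: "left_module (Poly_Mapping.single 0 1) (cok_poly A)"
  unfolding cok_poly_def dims by (rule left_module_quotient)

lemma cok_t_coset:
  "v \<in> carrier_vec n \<Longrightarrow> cok_t A (cok_image A +>\<^bsub>F\<^esub> v) = cok_image A +>\<^bsub>F\<^esub> (t \<cdot>\<^sub>v v)"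
  unfolding cok_t_def cok_poly_def dims by (subst quotient_smult) simp_all

lemma cok_t_inv_coset:
  assumes "v \<in> carrier_vec n"
  shows "cok_t_inv A (cok_image A +>\<^bsub>F\<^esub> v) = cok_image A +>\<^bsub>F\<^esub> (v \<^sub>v* C)"
  unfolding cok_t_inv_def dims
proof (rule UN_coset)
  have diff: "(y - z) \<^sub>v* C = y \<^sub>v* C - z \<^sub>v* C"
    if "y \<in> carrier_vec n" "z \<in> carrier_vec n" for y z
    using that dims(2)
    by (intro eq_vecI) (auto simp: vec_mult_mat_index[OF dims(2)] left_diff_distrib sum_subtractf
        simp del: index_map_mat)
  fix y z
  assume y: "y \<in> carrier F" and z: "z \<in> carrier F" and "y \<ominus>\<^bsub>F\<^esub> z \<in> cok_image A"
  then obtain u where u: "u \<in> carrier_vec n" "y - z = u \<^sub>v* I_minus_tA A"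
    by (auto simp: cok_image_def dims free_module_minus)
  have "y \<^sub>v* C - z \<^sub>v* C = (u - t \<cdot>\<^sub>v (u \<^sub>v* C)) \<^sub>v* C"
    using y z u vec_mult_I_minus_tA[OF A u(1)] diff[of y z] by simp
  also have "\<dots> = (u \<^sub>v* C) \<^sub>v* I_minus_tA A"
    using u dims(2)
    by (simp add: vec_mult_I_minus_tA[OF A] diff vec_mult_mat_smult[of _ n n] del: One_nat_def)
  finally show "y \<^sub>v* C \<ominus>\<^bsub>F\<^esub> z \<^sub>v* C \<in> cok_image A"
    using y z u dims(2) by (auto simp: cok_image_def dims(1) free_module_minus)
qed (use assms dims in auto)

lemma module_automorphism_cok:
  "module_automorphism (restrict_scalars (Poly_Mapping.single 0) (cok_poly A)) (cok_t A) (cok_t_inv A)"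
proof (intro module_automorphism.intro module_automorphism_axioms.intro)
  show "left_module 1 (restrict_scalars (Poly_Mapping.single 0) (cok_poly A))"
    by (rule left_module_restrict_scalars[OF left_module_cok_poly])
      (auto simp: single_add mult_single)
  interpret cok: left_module "Poly_Mapping.single 0 1" "cok_poly A"
    by (rule left_module_cok_poly)
  have carr: "carrier (cok_poly A) = (\<lambda>v. cok_image A +>\<^bsub>F\<^esub> v) ` carrier_vec n"
    unfolding cok_poly_def dims by (simp add: quotient_carrier)
  fix X Y r
  assume "X \<in> carrier (restrict_scalars (Poly_Mapping.single 0) (cok_poly A))"
  then have X: "X \<in> carrier (cok_poly A)"
    by (simp add: restrict_scalars_def)
  then obtain v where v: "v \<in> carrier_vec n" "X = cok_image A +>\<^bsub>F\<^esub> v"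
    by (auto simp: carr)
  have vC: "v \<^sub>v* C \<in> carrier_vec n"
    using dims by simp
  have "v - t \<cdot>\<^sub>v (v \<^sub>v* C) \<in> cok_image A"
    using v(1) vec_mult_I_minus_tA[OF A v(1)] unfolding cok_image_def dims(1) by (metis imageI)
  then have *: "cok_image A +>\<^bsub>F\<^esub> (t \<cdot>\<^sub>v (v \<^sub>v* C)) = cok_image A +>\<^bsub>F\<^esub> v"
    using v vC coset_eq_iff[of v "t \<cdot>\<^sub>v (v \<^sub>v* C)"] by (simp add: free_module_minus del: One_nat_def)
  show "cok_t A (cok_t_inv A X) = X"
    using v vC * by (simp add: cok_t_coset cok_t_inv_coset del: One_nat_def)
  show "cok_t_inv A (cok_t A X) = X"
    using v vC * dims(2) by (simp add: cok_t_coset cok_t_inv_coset vec_mult_mat_smult[of _ n n] del: One_nat_def)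
  show "cok_t A X \<in> carrier (restrict_scalars (Poly_Mapping.single 0) (cok_poly A))"
    using X by (simp add: cok_t_def restrict_scalars_def)
  show "cok_t_inv A X \<in> carrier (restrict_scalars (Poly_Mapping.single 0) (cok_poly A))"
    using v vC by (simp add: restrict_scalars_def cok_t_inv_coset carr)
  show "cok_t A (r \<odot>\<^bsub>restrict_scalars (Poly_Mapping.single 0) (cok_poly A)\<^esub> X) =
     r \<odot>\<^bsub>restrict_scalars (Poly_Mapping.single 0) (cok_poly A)\<^esub> cok_t A X"
    using X by (simp add: cok_t_def restrict_scalars_def cok.smult_assoc[symmetric] mult_single)
  assume "Y \<in> carrier (restrict_scalars (Poly_Mapping.single 0) (cok_poly A))"
  then show "cok_t A (X \<oplus>\<^bsub>restrict_scalars (Poly_Mapping.single 0) (cok_poly A)\<^esub> Y) =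
     cok_t A X \<oplus>\<^bsub>restrict_scalars (Poly_Mapping.single 0) (cok_poly A)\<^esub> cok_t A Y"
    using X by (simp add: cok_t_def restrict_scalars_def cok.smult_r_distr)
qed

lemma left_module_cok_laurent: "left_module (Poly_Mapping.single 0 1) (cok_laurent A)"
  unfolding cok_laurent_def
  by (intro module_automorphism.left_module_laurent_module module_automorphism_cok)

lemma cok_laurent_restrict:
  assumes X: "X \<in> carrier (cok_poly A)"
  shows "poly_to_laurent p \<odot>\<^bsub>cok_laurent A\<^esub> X = p \<odot>\<^bsub>cok_poly A\<^esub> X"
proof -
  interpret cok: left_module "Poly_Mapping.single 0 1" "cok_poly A"
    by (rule left_module_cok_poly)
  interpret aut: module_automorphism "restrict_scalars (Poly_Mapping.single 0) (cok_poly A)"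
    "cok_t A" "cok_t_inv A"
    by (rule module_automorphism_cok)
  have X': "X \<in> carrier (restrict_scalars (Poly_Mapping.single 0) (cok_poly A))"
    using X by (simp add: restrict_scalars_def)
  show ?thesis
  proof (induction p rule: poly_mapping_additive_induct)
    case zero
    have "0 \<odot>\<^bsub>cok_poly A\<^esub> X = \<zero>\<^bsub>cok_poly A\<^esub>"
      using cok.smult_l_distr[OF X, of 0 0] X by simp
    then show ?case
      by (simp add: cok_laurent_def) (simp add: restrict_scalars_def)
  next
    case (single k a)
    have "(cok_t A ^^ k) X = Poly_Mapping.single k 1 \<odot>\<^bsub>cok_poly A\<^esub> X"
      by (induction k)
        (use X in \<open>simp_all add: cok_t_def cok.smult_assoc[symmetric] mult_single\<close>)
    then show ?case
      using X X' by (simp add: cok_laurent_def aut.act_single int_iterate_def)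
        (simp add: restrict_scalars_def cok.smult_assoc[symmetric] mult_single)
  next
    case (add p q)
    then show ?case
      using X X' by (simp add: poly_to_laurent_add cok_laurent_def aut.act_plus cok.smult_l_distr)
        (simp add: restrict_scalars_def)
  qed
qed

end

subsection \<open>Direct limits\<close>

context
  fixes A :: "'a::{ring, monoid_mult} mat" and n :: nat
  assumes A: "A \<in> carrier_mat n n"
begin

private abbreviation it :: "nat \<Rightarrow> 'a vec \<Rightarrow> 'a vec" where
  "it p \<equiv> (\<lambda>u. u \<^sub>v* A) ^^ p"

private lemma dim: "dim_row A = n"
  using A by simp

private lemma it_closed [simp]: "v \<in> carrier_vec n \<Longrightarrow> it p v \<in> carrier_vec n"
  by (induction p) (use A in auto)

private lemma it_it: "it p (it q v) = it (p + q) v"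
  by (simp add: funpow_add)

private lemma it_add:
  "\<lbrakk>v \<in> carrier_vec n; w \<in> carrier_vec n\<rbrakk> \<Longrightarrow> it p (v + w) = it p v + it p w"
  by (induction p) (use A in \<open>auto simp: vec_mult_mat_add[of _ n n]\<close>)

private lemma it_smult: "v \<in> carrier_vec n \<Longrightarrow> it p (r \<cdot>\<^sub>v v) = r \<cdot>\<^sub>v it p v"
  by (induction p) (use A in \<open>auto simp: vec_mult_mat_smult[of _ n n]\<close>)

private lemma it_zero [simp]: "it p (0\<^sub>v n) = 0\<^sub>v n"
  by (induction p) (use A in \<open>auto simp: vec_mult_mat_zero[of _ n n]\<close>)

lemma dirlim_rel_iff:
  "((v, m), (w, k)) \<in> dirlim_rel A \<longleftrightarrow> v \<in> carrier_vec n \<and> w \<in> carrier_vec n \<and>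
    (\<exists>p q. m + p = k + q \<and> it p v = it q w)"
  by (simp add: dirlim_rel_def dim)

lemma equiv_dirlim_rel: "equiv (carrier_vec n \<times> UNIV) (dirlim_rel A)"
proof (intro equivI symI transI)
  show "dirlim_rel A \<subseteq> (carrier_vec n \<times> UNIV) \<times> (carrier_vec n \<times> UNIV)"
    by (auto simp: dirlim_rel_def dim)
  show "refl_on (carrier_vec n \<times> UNIV) (dirlim_rel A)"
    by (auto simp: refl_on_def dirlim_rel_iff)
next
  fix x y z
  assume xy: "(x, y) \<in> dirlim_rel A" and yz: "(y, z) \<in> dirlim_rel A"
  obtain v m w k u l where xyz: "x = (v, m)" "y = (w, k)" "z = (u, l)"
    by (cases x, cases y, cases z)
  obtain p q where 1: "v \<in> carrier_vec n" "m + p = k + q" "it p v = it q w"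
    using xy unfolding xyz dirlim_rel_iff by blast
  obtain p' q' where 2: "u \<in> carrier_vec n" "k + p' = l + q'" "it p' w = it q' u"
    using yz unfolding xyz dirlim_rel_iff by blast
  have "it (p' + p) v = it (p' + q) w"
    using 1 by (simp add: it_it[symmetric])
  also have "\<dots> = it q (it p' w)"
    by (simp add: it_it add.commute)
  also have "\<dots> = it (q + q') u"
    using 2 by (simp add: it_it)
  finally have "it (p' + p) v = it (q + q') u" .
  moreover have "m + (p' + p) = l + (q + q')"
    using 1 2 by simp
  ultimately show "(x, z) \<in> dirlim_rel A"
    using 1 2 unfolding xyz dirlim_rel_iff by blast
next
  fix x y
  assume xy: "(x, y) \<in> dirlim_rel A"
  obtain v m w k where xyz: "x = (v, m)" "y = (w, k)"
    by (cases x, cases y)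
  obtain p q where "v \<in> carrier_vec n" "w \<in> carrier_vec n" "k + q = m + p" "it q w = it p v"
    using xy unfolding xyz dirlim_rel_iff by metis
  then show "(y, x) \<in> dirlim_rel A"
    unfolding xyz dirlim_rel_iff by blast
qed

lemma dirlim_class_eq_iff:
  assumes "v \<in> carrier_vec n" "w \<in> carrier_vec n"
  shows "dirlim_class A v m = dirlim_class A w k \<longleftrightarrow>
    (\<exists>p q. m + p = k + q \<and> it p v = it q w)"
  unfolding dirlim_class_def using eq_equiv_class_iff[OF equiv_dirlim_rel, of "(v, m)" "(w, k)"] assms
  by (simp add: dirlim_rel_iff)

lemma dirlim_class_eqI:
  assumes "v \<in> carrier_vec n" "w \<in> carrier_vec n" "m + p = k + q" "it p v = it q w"
  shows "dirlim_class A v m = dirlim_class A w k"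
  using assms by (subst dirlim_class_eq_iff) blast+

lemma dirlim_class_shift:
  assumes "v \<in> carrier_vec n"
  shows "dirlim_class A (it j v) (m + j) = dirlim_class A v m"
  by (rule dirlim_class_eqI[where p = 0 and q = j]) (use assms in simp_all)

lemma dirlim_class_self: "v \<in> carrier_vec n \<Longrightarrow> (v, m) \<in> dirlim_class A v m"
  unfolding dirlim_class_def Image_singleton_iff dirlim_rel_iff by blast

lemma dirlim_carrier: "carrier (dirlim A) = {dirlim_class A v m | v m. v \<in> carrier_vec n}"
  unfolding dirlim_def module.simps partial_object.simps quotient_def dirlim_class_def dim by blast

lemma UN_dirlim_class:
  assumes v: "v \<in> carrier_vec n"
    and eq: "\<And>w k p q. \<lbrakk>w \<in> carrier_vec n; m + p = k + q; it p v = it q w\<rbrakk> \<Longrightarrow> f w k = f v m"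
  shows "(\<Union>(w, k)\<in>dirlim_class A v m. f w k) = f v m"
proof -
  have "(\<Union>(w, k)\<in>dirlim_class A v m. f w k) = (\<Union>x\<in>dirlim_class A v m. f v m)"
  proof (rule SUP_cong[OF refl])
    fix x assume x: "x \<in> dirlim_class A v m"
    obtain w k where wk: "x = (w, k)"
      by (cases x)
    have "((v, m), (w, k)) \<in> dirlim_rel A"
      using x unfolding wk dirlim_class_def by blast
    then have "f w k = f v m"
      unfolding dirlim_rel_iff using eq by blast
    then show "(case x of (w, k) \<Rightarrow> f w k) = f v m"
      by (simp add: wk)
  qed
  then show ?thesis
    using dirlim_class_self[OF v, of m] by blast
qed

lemma dirlim_add:
  assumes v: "v \<in> carrier_vec n" and w: "w \<in> carrier_vec n"
  shows "dirlim_class A v m \<oplus>\<^bsub>dirlim A\<^esub> dirlim_class A w k = dirlim_class A (it k v + it m w) (m + k)"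
proof -
  have 1: "dirlim_class A (it k v' + it m' w) (m' + k) = dirlim_class A (it k v + it m w) (m + k)"
    if "v' \<in> carrier_vec n" "m + p = m' + q" "it p v = it q v'" for v' m' p q
  proof -
    have "it p (it k v + it m w) = it k (it p v) + it (m + p) w"
      using v w by (simp add: it_add it_it ac_simps)
    also have "\<dots> = it q (it k v' + it m' w)"
      using that v w by (simp add: it_add it_it ac_simps)
    finally show ?thesis
      using that v w by (intro dirlim_class_eqI[where p = q and q = p]) simp_all
  qed
  have inner: "(\<Union>(w', k')\<in>dirlim_class A w k. dirlim_class A (it k' v' + it m' w') (m' + k')) =
      dirlim_class A (it k v' + it m' w) (m' + k)" if "v' \<in> carrier_vec n" for v' m'
  proof (rule UN_dirlim_class[OF w, where f = "\<lambda>w' k'. dirlim_class A (it k' v' + it m' w') (m' + k')"])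
    fix w' k' p q
    assume w': "w' \<in> carrier_vec n" "k + p = k' + q" "it p w = it q w'"
    have "it p (it k v' + it m' w) = it (k + p) v' + it m' (it p w)"
      using that w by (simp add: it_add it_it ac_simps)
    also have "\<dots> = it q (it k' v' + it m' w')"
      using that w' by (simp add: it_add it_it ac_simps)
    finally show "dirlim_class A (it k' v' + it m' w') (m' + k') = dirlim_class A (it k v' + it m' w) (m' + k)"
      using that w w' by (intro dirlim_class_eqI[where p = q and q = p]) simp_all
  qed
  have "(\<Union>(v', m')\<in>dirlim_class A v m. \<Union>(w', k')\<in>dirlim_class A w k.
        dirlim_class A (it k' v' + it m' w') (m' + k')) =
      (\<Union>(v', m')\<in>dirlim_class A v m. dirlim_class A (it k v' + it m' w) (m' + k))"
  proof (rule SUP_cong[OF refl])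
    fix x assume x: "x \<in> dirlim_class A v m"
    obtain v' m' where x': "x = (v', m')"
      by (cases x)
    have "((v, m), (v', m')) \<in> dirlim_rel A"
      using x unfolding x' dirlim_class_def by blast
    then have "v' \<in> carrier_vec n"
      unfolding dirlim_rel_iff by blast
    then show "(case x of (v', m') \<Rightarrow> \<Union>(w', k')\<in>dirlim_class A w k.
          dirlim_class A (it k' v' + it m' w') (m' + k')) =
        (case x of (v', m') \<Rightarrow> dirlim_class A (it k v' + it m' w) (m' + k))"
      unfolding x' prod.case by (rule inner)
  qed
  also have "\<dots> = dirlim_class A (it k v + it m w) (m + k)"
    by (rule UN_dirlim_class[OF v, where f = "\<lambda>v' m'. dirlim_class A (it k v' + it m' w) (m' + k)"])
      (rule 1, auto)
  finally show ?thesis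
    by (simp add: dirlim_def)
qed

lemma dirlim_smult:
  assumes v: "v \<in> carrier_vec n"
  shows "r \<odot>\<^bsub>dirlim A\<^esub> dirlim_class A v m = dirlim_class A (r \<cdot>\<^sub>v v) m"
  unfolding dirlim_def module.simps
proof (rule UN_dirlim_class[OF v, where f = "\<lambda>v m. dirlim_class A (r \<cdot>\<^sub>v v) m"])
  fix w k p q
  assume w: "w \<in> carrier_vec n" "m + p = k + q" "it p v = it q w"
  then show "dirlim_class A (r \<cdot>\<^sub>v w) k = dirlim_class A (r \<cdot>\<^sub>v v) m"
    using v by (intro dirlim_class_eqI[where p = q and q = p]) (simp_all add: it_smult)
qed

lemma dirlim_hat_class:
  assumes v: "v \<in> carrier_vec n"
  shows "dirlim_hat A (dirlim_class A v m) = dirlim_class A (v \<^sub>v* A) m"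
  unfolding dirlim_hat_def
proof (rule UN_dirlim_class[OF v, where f = "\<lambda>v m. dirlim_class A (v \<^sub>v* A) m"])
  fix w k p q
  assume w: "w \<in> carrier_vec n" "m + p = k + q" "it p v = it q w"
  have "it p (v \<^sub>v* A) = it p v \<^sub>v* A" "it q (w \<^sub>v* A) = it q w \<^sub>v* A"
    using funpow_swap1[of "\<lambda>u. u \<^sub>v* A" p v] funpow_swap1[of "\<lambda>u. u \<^sub>v* A" q w] by simp_all
  then show "dirlim_class A (w \<^sub>v* A) k = dirlim_class A (v \<^sub>v* A) m"
    using w A by (intro dirlim_class_eqI[where p = q and q = p]) simp_all
qed

lemma dirlim_hat_inv_class:
  assumes v: "v \<in> carrier_vec n"
  shows "dirlim_hat_inv A (dirlim_class A v m) = dirlim_class A v (Suc m)"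
  unfolding dirlim_hat_inv_def
proof (rule UN_dirlim_class[OF v, where f = "\<lambda>v m. dirlim_class A v (Suc m)"])
  fix w k p q
  assume "w \<in> carrier_vec n" "m + p = k + q" "it p v = it q w"
  then show "dirlim_class A w (Suc k) = dirlim_class A v (Suc m)"
    using v by (intro dirlim_class_eqI[where p = q and q = p]) simp_all
qed

lemma dirlim_zero: "\<zero>\<^bsub>dirlim A\<^esub> = dirlim_class A (0\<^sub>v n) m"
  using dirlim_class_shift[of "0\<^sub>v n" m 0] by (simp add: dirlim_def dim)

lemma left_module_dirlim: "left_module 1 (dirlim A)"
proof (intro left_module.intro left_module_axioms.intro abelian_groupI)
  fix X Y Z
  assume "X \<in> carrier (dirlim A)" "Y \<in> carrier (dirlim A)"
  then obtain v m w k where X: "X = dirlim_class A v m" "v \<in> carrier_vec n"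
    and Y: "Y = dirlim_class A w k" "w \<in> carrier_vec n"
    by (auto simp: dirlim_carrier)
  show "X \<oplus>\<^bsub>dirlim A\<^esub> Y \<in> carrier (dirlim A)"
    using X Y A by (auto simp: dirlim_add dirlim_carrier intro!: exI add_carrier_vec)
  show "X \<oplus>\<^bsub>dirlim A\<^esub> Y = Y \<oplus>\<^bsub>dirlim A\<^esub> X"
    using X Y by (simp add: dirlim_add add.commute comm_add_vec[of _ n])
  show "r \<odot>\<^bsub>dirlim A\<^esub> (X \<oplus>\<^bsub>dirlim A\<^esub> Y) = r \<odot>\<^bsub>dirlim A\<^esub> X \<oplus>\<^bsub>dirlim A\<^esub> r \<odot>\<^bsub>dirlim A\<^esub> Y" for r
    using X Y by (simp add: dirlim_add dirlim_smult it_smult smult_add_distrib_vec[of _ n])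
  assume "Z \<in> carrier (dirlim A)"
  then obtain u l where Z: "Z = dirlim_class A u l" "u \<in> carrier_vec n"
    by (auto simp: dirlim_carrier)
  show "X \<oplus>\<^bsub>dirlim A\<^esub> Y \<oplus>\<^bsub>dirlim A\<^esub> Z = X \<oplus>\<^bsub>dirlim A\<^esub> (Y \<oplus>\<^bsub>dirlim A\<^esub> Z)"
    using X Y Z by (simp add: dirlim_add it_add it_it ac_simps assoc_add_vec[of _ n])
next
  show "\<zero>\<^bsub>dirlim A\<^esub> \<in> carrier (dirlim A)"
    by (auto simp: dirlim_carrier dirlim_zero[of 0] intro!: exI[of _ "0\<^sub>v n"])
next
  fix X r s
  assume "X \<in> carrier (dirlim A)"
  then obtain v m where X: "X = dirlim_class A v m" "v \<in> carrier_vec n"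
    by (auto simp: dirlim_carrier)
  show "\<zero>\<^bsub>dirlim A\<^esub> \<oplus>\<^bsub>dirlim A\<^esub> X = X"
    using X by (simp add: dirlim_add dirlim_zero[of 0])
  have "dirlim_class A (- v) m \<oplus>\<^bsub>dirlim A\<^esub> X = \<zero>\<^bsub>dirlim A\<^esub>"
    using X by (simp add: dirlim_add it_add[symmetric] uminus_l_inv_vec dirlim_zero[of "m + m"])
  moreover have "dirlim_class A (- v) m \<in> carrier (dirlim A)"
    using X by (auto simp: dirlim_carrier intro!: exI[of _ "- v"])
  ultimately show "\<exists>Y\<in>carrier (dirlim A). Y \<oplus>\<^bsub>dirlim A\<^esub> X = \<zero>\<^bsub>dirlim A\<^esub>"
    by blast
  show "r \<odot>\<^bsub>dirlim A\<^esub> X \<in> carrier (dirlim A)"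
    using X by (auto simp: dirlim_carrier dirlim_smult intro!: exI[of _ "r \<cdot>\<^sub>v v"])
  have "(r * s) \<cdot>\<^sub>v v = r \<cdot>\<^sub>v (s \<cdot>\<^sub>v v)"
    by (simp add: vec_eq_iff mult.assoc)
  then show "(r * s) \<odot>\<^bsub>dirlim A\<^esub> X = r \<odot>\<^bsub>dirlim A\<^esub> (s \<odot>\<^bsub>dirlim A\<^esub> X)"
    using X by (simp add: dirlim_smult)
  have "1 \<cdot>\<^sub>v v = v"
    by (simp add: smult_vec_def vec_eq_iff)
  then show "1 \<odot>\<^bsub>dirlim A\<^esub> X = X"
    using X by (simp add: dirlim_smult)
  show "(r + s) \<odot>\<^bsub>dirlim A\<^esub> X = r \<odot>\<^bsub>dirlim A\<^esub> X \<oplus>\<^bsub>dirlim A\<^esub> s \<odot>\<^bsub>dirlim A\<^esub> X"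
    using X dirlim_class_shift[of "(r + s) \<cdot>\<^sub>v v" m m]
    by (simp add: dirlim_add dirlim_smult it_add[symmetric] add_smult_distrib_vec)
qed

lemma module_automorphism_dirlim:
  "module_automorphism (dirlim A) (dirlim_hat_inv A) (dirlim_hat A)"
proof (intro module_automorphism.intro module_automorphism_axioms.intro left_module_dirlim)
  fix X Y r
  assume "X \<in> carrier (dirlim A)"
  then obtain v m where X: "X = dirlim_class A v m" "v \<in> carrier_vec n"
    by (auto simp: dirlim_carrier)
  have vA: "v \<^sub>v* A \<in> carrier_vec n"
    using A by simp
  show "dirlim_hat_inv A X \<in> carrier (dirlim A)" "dirlim_hat A X \<in> carrier (dirlim A)"
    using X vA by (auto simp: dirlim_hat_inv_class dirlim_hat_class dirlim_carrier)
  show "dirlim_hat_inv A (dirlim_hat A X) = X" "dirlim_hat A (dirlim_hat_inv A X) = X"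
    using X vA dirlim_class_shift[OF X(2), of 1 m]
    by (simp_all add: dirlim_hat_inv_class dirlim_hat_class)
  show "dirlim_hat_inv A (r \<odot>\<^bsub>dirlim A\<^esub> X) = r \<odot>\<^bsub>dirlim A\<^esub> dirlim_hat_inv A X"
    using X by (simp add: dirlim_hat_inv_class dirlim_smult)
  assume "Y \<in> carrier (dirlim A)"
  then obtain w k where Y: "Y = dirlim_class A w k" "w \<in> carrier_vec n"
    by (auto simp: dirlim_carrier)
  have "it (Suc k) v + it (Suc m) w = it 1 (it k v + it m w)"
    using X Y by (simp only: it_add it_it it_closed) simp
  then show "dirlim_hat_inv A (X \<oplus>\<^bsub>dirlim A\<^esub> Y) =
      dirlim_hat_inv A X \<oplus>\<^bsub>dirlim A\<^esub> dirlim_hat_inv A Y"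
    using X Y dirlim_class_shift[of "it k v + it m w" 1 "Suc (m + k)"]
    by (simp add: dirlim_add dirlim_hat_inv_class del: funpow.simps)
qed

lemma left_module_dirlim_laurent: "left_module (Poly_Mapping.single 0 1) (dirlim_laurent A)"
  unfolding dirlim_laurent_def
  by (intro module_automorphism.left_module_laurent_module module_automorphism_dirlim)

lemma left_module_dirlim_poly: "left_module (Poly_Mapping.single 0 1) (dirlim_poly A)"
  unfolding dirlim_poly_def
  by (rule left_module_restrict_scalars[OF left_module_dirlim_laurent])
    (simp_all add: poly_to_laurent_add poly_to_laurent_mult)

end

end

theory Submission
  imports Defs
begin

text \<open>
  A map between direct limits is an isomorphism over the (Laurent) polynomials if and only if it
  is an isomorphism over the coefficient ring that commutes with \<open>t\<close>. The map \<open>[(v, m)] \<mapsto> [v t\<^sup>m]\<close> from the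
  direct limit to the cokernel is such an isomorphism: if \<open>v t\<^sup>m = u (I - tA)\<close>, comparing
  coefficients gives \<open>u\<^bsub>m+p\<^esub> = v A\<^sup>p\<close>, which vanishes for large \<open>p\<close>. If \<open>R, S\<close> is a shift
  equivalence then \<open>[(v, m)] \<mapsto> [(v R, m)]\<close> is an isomorphism of direct limits. Conversely, the images
  of the finitely many classes of unit vectors under an isomorphism of direct limits are represented
  in one common copy \<open>k\<close>, so the isomorphism has the form \<open>[(v, j)] \<mapsto> [(v R, k + j)]\<close>; the
  matrices obtained from it and its inverse satisfy the equations of a shift equivalence up to
  multiplication with a power of \<open>A\<close> or \<open>B\<close>, which can be absorbed into them.
\<close>

section \<open>Isomorphisms of modules\<close>

lemma module_isoI:
  assumes "bij_betw f (carrier M) (carrier N)"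
    and "\<And>x y. \<lbrakk>x \<in> carrier M; y \<in> carrier M\<rbrakk> \<Longrightarrow> f (x \<oplus>\<^bsub>M\<^esub> y) = f x \<oplus>\<^bsub>N\<^esub> f y"
    and "\<And>r x. x \<in> carrier M \<Longrightarrow> f (r \<odot>\<^bsub>M\<^esub> x) = r \<odot>\<^bsub>N\<^esub> f x"
  shows "f \<in> module_iso M N"
  using assms by (simp add: module_iso_def)

lemma module_isoD:
  assumes "f \<in> module_iso M N"
  shows "bij_betw f (carrier M) (carrier N)"
    and "x \<in> carrier M \<Longrightarrow> f x \<in> carrier N"
    and "\<lbrakk>x \<in> carrier M; y \<in> carrier M\<rbrakk> \<Longrightarrow> f (x \<oplus>\<^bsub>M\<^esub> y) = f x \<oplus>\<^bsub>N\<^esub> f y"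
    and "x \<in> carrier M \<Longrightarrow> f (r \<odot>\<^bsub>M\<^esub> x) = r \<odot>\<^bsub>N\<^esub> f x"
  using assms by (auto simp: module_iso_def dest: bij_betwE)

lemma inv_into_carrier:
  assumes "bij_betw f (carrier M) (carrier N)" "y \<in> carrier N"
  shows "inv_into (carrier M) f y \<in> carrier M" "f (inv_into (carrier M) f y) = y"
  using assms by (auto simp: bij_betw_def inv_into_into f_inv_into_f)

lemma inv_into_carrier_eq:
  assumes "bij_betw f (carrier M) (carrier N)" "x \<in> carrier M" "f x = y"
  shows "inv_into (carrier M) f y = x"
  using assms by (auto simp: bij_betw_def)

text \<open>Closure of \<open>M\<close> under its operations puts the candidate preimage into the
  carrier; injectivity of \<open>f\<close> then identifies it with the value of the inverse.\<close>

lemma module_iso_inv_into: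
  assumes "left_module e M" and f: "f \<in> module_iso M N"
  shows "inv_into (carrier M) f \<in> module_iso N M"
proof -
  interpret left_module e M by fact
  note bij = module_isoD(1)[OF f]
  show ?thesis
    by (rule module_isoI[OF bij_betw_inv_into[OF bij]])
      (auto intro!: inv_into_carrier_eq[OF bij] simp: inv_into_carrier[OF bij] module_isoD(3,4)[OF f])
qed

lemma module_isomorphic_sym: "left_module e M \<Longrightarrow> M \<cong>\<^sub>m N \<Longrightarrow> N \<cong>\<^sub>m M"
  unfolding module_isomorphic_def using module_iso_inv_into by blast

lemma module_iso_comp:
  assumes "f \<in> module_iso M N" "g \<in> module_iso N P"
  shows "g \<circ> f \<in> module_iso M P"
  using assms by (intro module_isoI) (auto intro: bij_betw_trans module_isoD(1) simp: module_isoD)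

lemma module_isomorphic_trans: "M \<cong>\<^sub>m N \<Longrightarrow> N \<cong>\<^sub>m P \<Longrightarrow> M \<cong>\<^sub>m P"
  unfolding module_isomorphic_def using module_iso_comp by blast

text \<open>Serves to transport statements about direct limits to cokernels. One direction inverts
  the isomorphism out of \<open>M\<close>, the other the one out of \<open>M'\<close>, which is
  where the module axioms enter.\<close>

lemma module_isomorphic_cong:
  assumes "left_module e M" "left_module e' M'" "M \<cong>\<^sub>m N" "M' \<cong>\<^sub>m N'"
  shows "M \<cong>\<^sub>m M' \<longleftrightarrow> N \<cong>\<^sub>m N'"
  using assms by (meson module_isomorphic_sym module_isomorphic_trans)

lemma module_iso_restrict_scalars:
  "f \<in> module_iso M N \<Longrightarrow> f \<in> module_iso (restrict_scalars h M) (restrict_scalars h N)"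
  by (simp add: module_iso_def restrict_scalars_def)

text \<open>The common middle term between isomorphism over polynomials and over Laurent
  polynomials. Here \<open>T\<close> and \<open>T'\<close> stand for the action of t; for
  automorphisms, compatibility with the action of its inverse follows.\<close>

definition equivariant_iso ::
  "('r, 'm, 'x) module_scheme \<Rightarrow> ('m \<Rightarrow> 'm) \<Rightarrow> ('r, 'n, 'y) module_scheme \<Rightarrow> ('n \<Rightarrow> 'n) \<Rightarrow>
    ('m \<Rightarrow> 'n) set" where
  "equivariant_iso M T N T' = {f \<in> module_iso M N. \<forall>x\<in>carrier M. f (T x) = T' (f x)}"

lemma equivariant_iso_inv_into:
  assumes M: "left_module e M" and T: "\<And>x. x \<in> carrier M \<Longrightarrow> T x \<in> carrier M"
    and f: "f \<in> equivariant_iso M T N T'"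
  shows "inv_into (carrier M) f \<in> equivariant_iso N T' M T"
proof -
  have iso: "f \<in> module_iso M N"
    using f by (simp add: equivariant_iso_def)
  note bij = module_isoD(1)[OF iso]
  show ?thesis
    using module_iso_inv_into[OF M iso] f
    by (auto simp: equivariant_iso_def inv_into_carrier[OF bij] T intro!: inv_into_carrier_eq[OF bij])
qed

lemma laurent_module_simps:
  "carrier (laurent_module M T U) = carrier M" "add (laurent_module M T U) = add M"
  by (simp_all add: laurent_module_def)

lemma restrict_scalars_simps [simp]:
  "carrier (restrict_scalars h M) = carrier M" "add (restrict_scalars h M) = add M"
  "smult (restrict_scalars h M) r = smult M (h r)"
  by (simp_all add: restrict_scalars_def)

context
  fixes M :: "('a::{ring, monoid_mult}, 'm, 'x) module_scheme" and T U
    and N :: "('a, 'n, 'y) module_scheme" and T' U'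
  assumes M: "module_automorphism M T U" and N: "module_automorphism N T' U'"
begin

interpretation M: module_automorphism M T U by (rule M)
interpretation N: module_automorphism N T' U' by (rule N)

text \<open>Commuting with \<open>T\<close> forces commuting with \<open>U\<close>, hence with all
  integer iterates. Both actions are additive in the Laurent polynomial, so monomials
  suffice.\<close>

lemma equivariant_iso_imp_laurent_iso:
  assumes f: "f \<in> equivariant_iso M T N T'"
  shows "f \<in> module_iso (laurent_module M T U) (laurent_module N T' U')"
proof -
  have iso: "f \<in> module_iso M N" and fT: "\<And>x. x \<in> carrier M \<Longrightarrow> f (T x) = T' (f x)"
    using f by (simp_all add: equivariant_iso_def)
  note f_simps = module_isoD(2-4)[OF iso]
  \<comment> \<open>\<open>fT\<close> at \<open>U x\<close> reads \<open>f x = T' (f (U x))\<close>;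
    applying \<open>U'\<close> gives the claim.\<close>
  have fU: "f (U x) = U' (f x)" if "x \<in> carrier M" for x
    using fT[of "U x"] N.U_T[of "f (U x)"] f_simps(1) that by simp
  have f0: "f \<zero>\<^bsub>M\<^esub> = \<zero>\<^bsub>N\<^esub>"
    using f_simps(2)[of "\<zero>\<^bsub>M\<^esub>" "\<zero>\<^bsub>M\<^esub>"] f_simps(1)[of "\<zero>\<^bsub>M\<^esub>"] by simp
  have it: "f (int_iterate T U k x) = int_iterate T' U' k (f x)" if x: "x \<in> carrier M" for k x
  proof -
    have "f ((T ^^ i) x) = (T' ^^ i) (f x)" "f ((U ^^ i) x) = (U' ^^ i) (f x)" for i
      by (induction i) (simp_all add: fT fU x M.funpow_T)
    then show ?thesis
      by (simp add: int_iterate_def)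
  qed
  have "f (M.act q x) = N.act q (f x)" if x: "x \<in> carrier M" for q x
    by (induction q rule: poly_mapping_additive_induct)
      (simp_all add: x f0 it f_simps M.act_single N.act_single M.act_plus N.act_plus)
  then show ?thesis
    using module_isoD[OF iso] by (intro module_isoI) (simp_all add: laurent_module_simps)
qed

text \<open>Constant polynomials recover the scalars of \<open>M\<close>, and the monomial t
  recovers \<open>T\<close>; the polynomial action therefore already contains all of the equivariant
  data.\<close>

lemma poly_iso_imp_equivariant_iso:
  assumes f: "f \<in> module_iso (restrict_scalars poly_to_laurent (laurent_module M T U))
    (restrict_scalars poly_to_laurent (laurent_module N T' U'))"
  shows "f \<in> equivariant_iso M T N T'"
proof -
  note f_simps = module_isoD[OF f, unfolded restrict_scalars_simps laurent_module_simps]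
  have single: "f (r \<odot>\<^bsub>M\<^esub> int_iterate T U (int k) x) = r \<odot>\<^bsub>N\<^esub> int_iterate T' U' (int k) (f x)"
    if "x \<in> carrier M" for k r x
    using f_simps(4)[OF that, of "Poly_Mapping.single k r"] that f_simps(2)[OF that]
    by (simp add: M.act_single N.act_single)
  have "f \<in> module_iso M N"
    using f_simps single[of _ _ 0] by (intro module_isoI) simp_all
  moreover have "f (T x) = T' (f x)" if "x \<in> carrier M" for x
    using single[OF that, of 1 1] that f_simps(2)[OF that] by (simp add: int_iterate_def)
  ultimately show ?thesis
    by (simp add: equivariant_iso_def)
qed

text \<open>This and the next equivalence come from a circle: equivariant implies Laurent, Laurent
  restricts to polynomial, polynomial implies equivariant.\<close>

lemma laurent_isomorphic_iff_equivariant: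
  "laurent_module M T U \<cong>\<^sub>m laurent_module N T' U' \<longleftrightarrow> equivariant_iso M T N T' \<noteq> {}"
  unfolding module_isomorphic_def
  using equivariant_iso_imp_laurent_iso poly_iso_imp_equivariant_iso module_iso_restrict_scalars by blast

lemma poly_isomorphic_iff_equivariant:
  "restrict_scalars poly_to_laurent (laurent_module M T U) \<cong>\<^sub>m
    restrict_scalars poly_to_laurent (laurent_module N T' U') \<longleftrightarrow> equivariant_iso M T N T' \<noteq> {}"
  unfolding module_isomorphic_def
  using equivariant_iso_imp_laurent_iso poly_iso_imp_equivariant_iso module_iso_restrict_scalars by blast

end

section \<open>Matrices acting on row vectors\<close>

abbreviation row_iterate :: "'a::semiring_0 mat \<Rightarrow> nat \<Rightarrow> 'a vec \<Rightarrow> 'a vec" where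
  "row_iterate A p \<equiv> (\<lambda>u. u \<^sub>v* A) ^^ p"

lemma row_iterate_closed [simp]:
  "A \<in> carrier_mat n n \<Longrightarrow> v \<in> carrier_vec n \<Longrightarrow> row_iterate A p v \<in> carrier_vec n"
  by (induction p) auto

lemma row_iterate_row_iterate: "row_iterate A p (row_iterate A q v) = row_iterate A (p + q) v"
  by (simp add: funpow_add)

lemma vec_mult_mat_assoc:
  fixes A B :: "'a::semiring_0 mat"
  assumes A: "A \<in> carrier_mat n m" and B: "B \<in> carrier_mat m k"
  shows "(v \<^sub>v* A) \<^sub>v* B = v \<^sub>v* (A * B)"
proof (rule eq_vecI)
  fix j assume "j < dim_vec (v \<^sub>v* (A * B))"
  then have j: "j < k"
    using B by simp
  have "((v \<^sub>v* A) \<^sub>v* B) $ j = (\<Sum>l<m. (\<Sum>i<n. v $ i * A $$ (i, l)) * B $$ (l, j))"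
    using j by (simp add: vec_mult_mat_index[OF B] vec_mult_mat_index[OF A])
  also have "\<dots> = (\<Sum>i<n. v $ i * (\<Sum>l<m. A $$ (i, l) * B $$ (l, j)))"
    by (simp add: sum_distrib_left sum_distrib_right mult.assoc) (rule sum.swap)
  also have "\<dots> = (v \<^sub>v* (A * B)) $ j"
    using A B j
    by (simp add: vec_mult_mat_index[OF mult_carrier_mat[OF A B]] scalar_prod_def atLeast0LessThan)
  finally show "((v \<^sub>v* A) \<^sub>v* B) $ j = (v \<^sub>v* (A * B)) $ j" .
qed (use B in simp)

lemma vec_mult_one_mat:
  fixes v :: "'a::{ring, monoid_mult} vec"
  assumes "v \<in> carrier_vec n"
  shows "v \<^sub>v* 1\<^sub>m n = v"
proof (rule eq_vecI)
  fix j assume "j < dim_vec v"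
  then have j: "j < n"
    using assms by simp
  have "(v \<^sub>v* 1\<^sub>m n) $ j = (\<Sum>i<n. if i = j then v $ i else 0)"
    unfolding vec_mult_mat_index[OF one_carrier_mat j] using j by (intro sum.cong) auto
  then show "(v \<^sub>v* 1\<^sub>m n) $ j = v $ j"
    using j by simp
qed (use assms in simp)

text \<open>The library's unit vectors exclude the zero ring, hence \<^term>\<open>row (1\<^sub>m n) i\<close>.\<close>

lemma row_one_mult_mat:
  fixes A :: "'a::{ring, monoid_mult} mat"
  assumes A: "A \<in> carrier_mat n m" and i: "i < n"
  shows "row (1\<^sub>m n) i \<^sub>v* A = row A i"
proof (rule eq_vecI)
  fix j assume "j < dim_vec (row A i)"
  then have j: "j < m"
    using A by simp
  have "(row (1\<^sub>m n) i \<^sub>v* A) $ j = (\<Sum>l<n. if l = i then A $$ (l, j) else 0)"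
    unfolding vec_mult_mat_index[OF A j] using i by (intro sum.cong) auto
  then show "(row (1\<^sub>m n) i \<^sub>v* A) $ j = row A i $ j"
    using A i j by simp
qed (use A in simp)

text \<open>Turns a matrix identity into one about row vectors, where powers become iterates. The
  vectors \<open>row (1\<^sub>m n) i\<close> are the standard basis.\<close>

lemma mat_eq_if_rows_eq:
  fixes A B :: "'a::{ring, monoid_mult} mat"
  assumes A: "A \<in> carrier_mat n m" and B: "B \<in> carrier_mat n m"
    and eq: "\<And>i. i < n \<Longrightarrow> row (1\<^sub>m n) i \<^sub>v* A = row (1\<^sub>m n) i \<^sub>v* B"
  shows "A = B"
  using eq A B by (intro eq_rowI) (simp_all add: row_one_mult_mat)

section \<open>Powers of a matrix and intertwining matrices\<close>

lemma mat_power_closed [simp]: "A \<in> carrier_mat n n \<Longrightarrow> mat_power A p \<in> carrier_mat n n"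
  by (induction p) auto

lemma vec_mult_mat_power:
  assumes A: "A \<in> carrier_mat n n" and v: "v \<in> carrier_vec n"
  shows "v \<^sub>v* mat_power A p = row_iterate A p v"
proof (induction p)
  case 0
  then show ?case
    using vec_mult_one_mat[OF v] A by simp
next
  case (Suc p)
  then show ?case
    using vec_mult_mat_assoc[OF mat_power_closed[OF A] A, of v p] by simp
qed

lemma mat_power_add:
  assumes A: "A \<in> carrier_mat n n"
  shows "mat_power A (p + q) = mat_power A p * mat_power A q"
proof -
  have "row (1\<^sub>m n) i \<^sub>v* mat_power A (p + q) = row (1\<^sub>m n) i \<^sub>v* (mat_power A p * mat_power A q)"
    if "i < n" for i
    using A that
    by (simp add: vec_mult_mat_assoc[symmetric, of _ n n _ n] vec_mult_mat_power row_iterate_row_iterate add.commute)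
  then show ?thesis
    using A by (intro mat_eq_if_rows_eq[of _ n n]) (simp_all add: mult_carrier_mat[of _ n n])
qed

lemma mat_power_intertwine:
  fixes A B R :: "'a::{ring, monoid_mult} mat"
  assumes A: "A \<in> carrier_mat n n" and B: "B \<in> carrier_mat m m" and R: "R \<in> carrier_mat n m"
    and eq: "A * R = R * B"
  shows "mat_power A p * R = R * mat_power B p"
proof (induction p)
  case 0
  have "1\<^sub>m n * R = R"
    by (rule mat_eq_if_rows_eq[OF mult_carrier_mat[OF one_carrier_mat R] R])
      (simp add: vec_mult_mat_assoc[OF one_carrier_mat R, symmetric] vec_mult_one_mat)
  moreover have "R * 1\<^sub>m m = R"
    by (rule mat_eq_if_rows_eq[OF mult_carrier_mat[OF R one_carrier_mat] R])
      (simp add: vec_mult_mat_assoc[OF R one_carrier_mat, symmetric] vec_mult_one_mat[OF vec_mult_mat_closed[OF R]])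
  ultimately show ?case
    using A B by simp
next
  case (Suc p)
  have "mat_power A p * A * R = mat_power A p * (R * B)"
    using A R by (simp add: eq assoc_mult_mat[of _ n n _ n _ m])
  also have "\<dots> = R * mat_power B p * B"
    using A B R by (simp add: Suc[symmetric] assoc_mult_mat[of _ n n _ m _ m])
  also have "\<dots> = R * (mat_power B p * B)"
    using B R by (simp add: assoc_mult_mat[of _ n m _ m _ m])
  finally show ?case
    by simp
qed

lemma row_iterate_intertwine:
  fixes A B R :: "'a::{ring, monoid_mult} mat"
  assumes A: "A \<in> carrier_mat n n" and B: "B \<in> carrier_mat m m" and R: "R \<in> carrier_mat n m"
    and eq: "A * R = R * B" and v: "v \<in> carrier_vec n"
  shows "row_iterate A p v \<^sub>v* R = row_iterate B p (v \<^sub>v* R)"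
  using mat_power_intertwine[OF A B R eq, of p] A B R v
  by (simp add: vec_mult_mat_power[symmetric, of _ n] vec_mult_mat_power[symmetric, of _ m]
      vec_mult_mat_assoc[of _ n n _ m] vec_mult_mat_assoc[of _ n m _ m])

text \<open>Generation of the row space by the standard basis: \<open>v\<close> is built through its
  truncations to the first \<open>d\<close> entries, each step adding one multiple of a basis
  vector.\<close>

lemma carrier_vec_induct [consumes 1, case_names zero row add]:
  fixes v :: "'a::{ring, monoid_mult} vec"
  assumes v: "v \<in> carrier_vec n" and zero: "P (0\<^sub>v n)"
    and row: "\<And>r i. i < n \<Longrightarrow> P (r \<cdot>\<^sub>v row (1\<^sub>m n) i)"
    and add: "\<And>v w. \<lbrakk>v \<in> carrier_vec n; w \<in> carrier_vec n; P v; P w\<rbrakk> \<Longrightarrow> P (v + w)"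
  shows "P v"
proof -
  have "P (vec n (\<lambda>i. if i < d then v $ i else 0))" if "d \<le> n" for d
    using that
  proof (induction d)
    case 0
    have "vec n (\<lambda>i. if i < 0 then v $ i else 0) = 0\<^sub>v n"
      by auto
    then show ?case
      using zero by simp
  next
    case (Suc d)
    let ?u = "vec n (\<lambda>i. if i < d then v $ i else 0)"
    have "P (?u + (v $ d) \<cdot>\<^sub>v row (1\<^sub>m n) d)"
      by (rule add) (use Suc row[of d] in \<open>auto intro!: carrier_vecI\<close>)
    also have "?u + (v $ d) \<cdot>\<^sub>v row (1\<^sub>m n) d = vec n (\<lambda>i. if i < Suc d then v $ i else 0)"
      using Suc.prems by (intro eq_vecI) (auto simp: less_Suc_eq)
    finally show ?case .
  qed
  moreover have "vec n (\<lambda>i. if i < n then v $ i else 0) = v"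
    using v by (intro eq_vecI) auto
  ultimately show ?thesis
    by (metis order_refl)
qed

section \<open>Isomorphisms of direct limits\<close>

lemma dirlim_class_closed:
  fixes A :: "'a::{ring, monoid_mult} mat"
  shows "A \<in> carrier_mat n n \<Longrightarrow> v \<in> carrier_vec n \<Longrightarrow> dirlim_class A v k \<in> carrier (dirlim A)"
  by (auto simp: dirlim_carrier)

lemma dirlim_carrierE:
  fixes A :: "'a::{ring, monoid_mult} mat"
  assumes "A \<in> carrier_mat n n" "X \<in> carrier (dirlim A)"
  obtains v k where "v \<in> carrier_vec n" "X = dirlim_class A v k"
  using assms by (auto simp: dirlim_carrier)

lemma dirlim_class_shift_mat_power:
  fixes A :: "'a::{ring, monoid_mult} mat"
  assumes "A \<in> carrier_mat n n" "v \<in> carrier_vec n"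
  shows "dirlim_class A (v \<^sub>v* mat_power A j) (k + j) = dirlim_class A v k"
  using assms by (simp add: vec_mult_mat_power dirlim_class_shift)

text \<open>The general sum lands in copy \<open>k + k\<close> with both vectors moved
  \<open>k\<close> steps; by additivity the whole sum can be moved back to copy
  \<open>k\<close>.\<close>

lemma dirlim_add_same:
  fixes A :: "'a::{ring, monoid_mult} mat"
  assumes A: "A \<in> carrier_mat n n" and v: "v \<in> carrier_vec n" and w: "w \<in> carrier_vec n"
  shows "dirlim_class A v k \<oplus>\<^bsub>dirlim A\<^esub> dirlim_class A w k = dirlim_class A (v + w) k"
proof -
  have "row_iterate A k v + row_iterate A k w = row_iterate A k (v + w)"
    using vec_mult_mat_add[OF mat_power_closed[OF A] v w, of k] v w A
    by (simp add: vec_mult_mat_power)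
  then show ?thesis
    using assms by (simp add: dirlim_add dirlim_class_shift)
qed

text \<open>The exponent is uniform because only the finitely many rows of the matrices matter.\<close>

lemma dirlim_class_mat_eqD:
  fixes B M N :: "'a::{ring, monoid_mult} mat"
  assumes B: "B \<in> carrier_mat m m" and M: "M \<in> carrier_mat n m" and N: "N \<in> carrier_mat n m"
    and eq: "\<And>v. v \<in> carrier_vec n \<Longrightarrow> dirlim_class B (v \<^sub>v* M) k = dirlim_class B (v \<^sub>v* N) k"
  shows "eventually (\<lambda>p. M * mat_power B p = N * mat_power B p) sequentially"
proof -
  have "eventually (\<lambda>p. row (1\<^sub>m n) i \<^sub>v* (M * mat_power B p) = row (1\<^sub>m n) i \<^sub>v* (N * mat_power B p))
      sequentially" (is "eventually (?P i) _") if i: "i < n" for i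
  proof -
    let ?e = "row (1\<^sub>m n) i :: 'a vec"
    have e: "?e \<^sub>v* M \<in> carrier_vec m" "?e \<^sub>v* N \<in> carrier_vec m"
      using M N by simp_all
    have "?e \<in> carrier_vec n"
      using i by simp
    \<comment> \<open>Both classes are given in copy \<open>k\<close>, so the two exponents of
      \<open>dirlim_class_eq_iff\<close> coincide.\<close>
    from eq[OF this] obtain p where p: "row_iterate B p (?e \<^sub>v* M) = row_iterate B p (?e \<^sub>v* N)"
      unfolding dirlim_class_eq_iff[OF B e] by auto
    have "?P i q" if "q \<ge> p" for q
    proof -
      have "row_iterate B q (?e \<^sub>v* M) = row_iterate B q (?e \<^sub>v* N)"
        using p that row_iterate_row_iterate[of "q - p" B p] by (metis le_add_diff_inverse2)
      then show ?thesis
        using vec_mult_mat_assoc[OF M mat_power_closed[OF B], of ?e q]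
          vec_mult_mat_assoc[OF N mat_power_closed[OF B], of ?e q] e B
        by (simp add: vec_mult_mat_power)
    qed
    then show ?thesis
      unfolding eventually_sequentially by blast
  qed
  \<comment> \<open>Equality after \<open>p\<close> steps persists after more steps, so finitely
    many rows have a common exponent.\<close>
  then have "eventually (\<lambda>p. \<forall>i\<in>{..<n}. ?P i p) sequentially"
    by (intro eventually_ball_finite) auto
  then show ?thesis
  proof eventually_elim
    case (elim p)
    show ?case
      by (rule mat_eq_if_rows_eq[of _ n m]) (use elim B M N in \<open>simp_all add: mult_carrier_mat[of _ n m]\<close>)
  qed
qed

text \<open>Linearity determines \<open>f\<close> on copy 0 from the basis vectors, and commuting
  with t carries the formula to every copy \<open>j\<close>. The intertwining equation first holds
  only between classes and becomes exact after multiplication by a power of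
  \<open>B\<close>.\<close>

lemma dirlim_iso_is_matrix:
  fixes A B :: "'a::{ring, monoid_mult} mat"
  assumes A: "A \<in> carrier_mat n n" and B: "B \<in> carrier_mat m m"
    and f: "f \<in> equivariant_iso (dirlim A) (dirlim_hat_inv A) (dirlim B) (dirlim_hat_inv B)"
  obtains R k where "R \<in> carrier_mat n m" "A * R = R * B"
    "\<And>v j. v \<in> carrier_vec n \<Longrightarrow> f (dirlim_class A v j) = dirlim_class B (v \<^sub>v* R) (k + j)"
proof -
  interpret A: module_automorphism "dirlim A" "dirlim_hat_inv A" "dirlim_hat A"
    by (rule module_automorphism_dirlim[OF A])
  interpret B: module_automorphism "dirlim B" "dirlim_hat_inv B" "dirlim_hat B"
    by (rule module_automorphism_dirlim[OF B])
  have iso: "f \<in> module_iso (dirlim A) (dirlim B)"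
    and fT: "\<And>X. X \<in> carrier (dirlim A) \<Longrightarrow> f (dirlim_hat_inv A X) = dirlim_hat_inv B (f X)"
    using f by (simp_all add: equivariant_iso_def)
  note f_simps = module_isoD(2-4)[OF iso]
  note A_class = dirlim_class_closed[OF A]
  have fU: "f (dirlim_hat A X) = dirlim_hat B (f X)" if "X \<in> carrier (dirlim A)" for X
    using fT[of "dirlim_hat A X"] B.U_T[of "f (dirlim_hat A X)"] f_simps(1) that by simp
  have f0: "f \<zero>\<^bsub>dirlim A\<^esub> = \<zero>\<^bsub>dirlim B\<^esub>"
    using f_simps(2)[of "\<zero>\<^bsub>dirlim A\<^esub>" "\<zero>\<^bsub>dirlim A\<^esub>"] f_simps(1)[of "\<zero>\<^bsub>dirlim A\<^esub>"] by simp
  let ?e = "\<lambda>i. row (1\<^sub>m n) i :: 'a vec"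
  have "\<exists>w l. w \<in> carrier_vec m \<and> f (dirlim_class A (?e i) 0) = dirlim_class B w l" if "i < n" for i
    using that dirlim_carrierE[OF B f_simps(1)[OF A_class[of "?e i" 0]]] by (metis row_carrier_vec one_carrier_mat)
  then obtain r l where r: "\<And>i. i < n \<Longrightarrow> r i \<in> carrier_vec m"
    and fe: "\<And>i. i < n \<Longrightarrow> f (dirlim_class A (?e i) 0) = dirlim_class B (r i) (l i)"
    by metis
  \<comment> \<open>The sum serves as a common upper bound of the finitely many copies
    \<open>l i\<close>.\<close>
  define k where "k = (\<Sum>i<n. l i)"
  \<comment> \<open>Row \<open>i\<close> is the representative \<open>r i\<close>, moved from copy
    \<open>l i\<close> to copy \<open>k\<close>.\<close>
  define R' where "R' = mat n m (\<lambda>(i, j). (r i \<^sub>v* mat_power B (k - l i)) $ j)"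
  have R': "R' \<in> carrier_mat n m"
    by (simp add: R'_def)
  have fe': "f (dirlim_class A (?e i) 0) = dirlim_class B (?e i \<^sub>v* R') k" if i: "i < n" for i
  proof -
    have "l i \<le> k"
      unfolding k_def using i by (intro member_le_sum) auto
    moreover have "row R' i = r i \<^sub>v* mat_power B (k - l i)"
    proof (rule eq_vecI)
      have dim: "dim_col (mat_power B (k - l i)) = m"
        using mat_power_closed[OF B, of "k - l i"] by (rule carrier_matD)
      then show "dim_vec (row R' i) = dim_vec (r i \<^sub>v* mat_power B (k - l i))"
        by (simp add: R'_def)
      fix j assume "j < dim_vec (r i \<^sub>v* mat_power B (k - l i))"
      then show "row R' i $ j = (r i \<^sub>v* mat_power B (k - l i)) $ j"
        using i dim by (simp add: R'_def)
    qed
    ultimately show ?thesis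
      using dirlim_class_shift_mat_power[OF B r[OF i], of "k - l i" "l i"] fe[OF i]
        row_one_mult_mat[OF R' i] by simp
  qed
  have fR': "f (dirlim_class A v 0) = dirlim_class B (v \<^sub>v* R') k" if "v \<in> carrier_vec n" for v
    using that
  proof (induction v rule: carrier_vec_induct)
    case zero
    then show ?case
      using f0 by (simp add: dirlim_zero[OF A, of 0] dirlim_zero[OF B, of k] vec_mult_mat_zero[OF R'])
  next
    case (row c i)
    then show ?case
      using R' by (simp add: dirlim_smult[OF A, symmetric] dirlim_smult[OF B, symmetric]
          vec_mult_mat_smult[of _ n m] f_simps A_class fe')
  next
    case (add v w)
    then show ?case
      using R' by (simp add: dirlim_add_same[OF A, symmetric] dirlim_add_same[OF B, symmetric]
          vec_mult_mat_add[of _ n m] f_simps A_class)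
  qed
  \<comment> \<open>Both sides are the image of [(vA, 0)], since \<open>f\<close> also commutes with
    \<open>dirlim_hat\<close>.\<close>
  have "dirlim_class B (v \<^sub>v* (A * R')) k = dirlim_class B (v \<^sub>v* (R' * B)) k"
    if v: "v \<in> carrier_vec n" for v
  proof -
    have "dirlim_class B ((v \<^sub>v* A) \<^sub>v* R') k = f (dirlim_hat A (dirlim_class A v 0))"
      using v A by (simp add: dirlim_hat_class[OF A] fR')
    also have "\<dots> = dirlim_class B ((v \<^sub>v* R') \<^sub>v* B) k"
      using v R' by (simp add: fU A_class fR' dirlim_hat_class[OF B])
    finally show ?thesis
      by (simp add: vec_mult_mat_assoc[OF A R'] vec_mult_mat_assoc[OF R' B])
  qed
  then obtain p where p: "(A * R') * mat_power B p = (R' * B) * mat_power B p"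
    using dirlim_class_mat_eqD[OF B mult_carrier_mat[OF A R'] mult_carrier_mat[OF R' B]]
    by (meson eventually_happens' sequentially_bot)
  \<comment> \<open>Replacing \<open>R'\<close> by \<open>R' * mat_power B p\<close> and
    \<open>k\<close> by \<open>k + p\<close> leaves the map unchanged and makes the intertwining
    exact.\<close>
  show ?thesis
  proof (rule that)
    show "R' * mat_power B p \<in> carrier_mat n m"
      using R' B by (simp add: mult_carrier_mat[of _ n m])
    have "A * (R' * mat_power B p) = R' * (B * mat_power B p)"
      using p A B R' by (simp add: assoc_mult_mat[of _ n n _ m _ m] assoc_mult_mat[of _ n m _ m _ m])
    also have "B * mat_power B p = mat_power B p * B"
      using mat_power_intertwine[OF B B B refl, of p] by simp
    finally show "A * (R' * mat_power B p) = R' * mat_power B p * B"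
      using B R' by (simp add: assoc_mult_mat[of _ n m _ m _ m])
    fix v :: "'a vec" and j assume v: "v \<in> carrier_vec n"
    show "f (dirlim_class A v j) = dirlim_class B (v \<^sub>v* (R' * mat_power B p)) (k + p + j)"
    proof (induction j)
      case 0
      then show ?case
        using v R' B by (simp add: fR' dirlim_class_shift_mat_power[OF B] vec_mult_mat_assoc[of _ n m _ m, symmetric])
    next
      case (Suc j)
      have "f (dirlim_class A v (Suc j)) = dirlim_hat_inv B (f (dirlim_class A v j))"
        using v by (simp add: dirlim_hat_inv_class[OF A, symmetric] fT A_class)
      then show ?case
        using Suc by (simp add: dirlim_hat_inv_class[OF B vec_mult_mat_closed[OF mult_carrier_mat[OF R' mat_power_closed[OF B]]]])
    qed
  qed
qed

section \<open>Shift equivalence and direct limits\<close>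

text \<open>The relation AR = RB makes the map induced by \<open>R\<close> well defined and
  additive; RS = A^l and SR = B^l supply an inverse induced by \<open>S\<close>.\<close>

lemma shift_equivalent_imp_equivariant_iso:
  fixes A B :: "'a::{ring, monoid_mult} mat"
  assumes A: "A \<in> carrier_mat n n" and B: "B \<in> carrier_mat m m" and "shift_equivalent A B"
  shows "equivariant_iso (dirlim A) (dirlim_hat_inv A) (dirlim B) (dirlim_hat_inv B) \<noteq> {}"
proof -
  obtain l R S where R: "R \<in> carrier_mat n m" and S: "S \<in> carrier_mat m n"
    and RS: "mat_power A l = R * S" and SR: "mat_power B l = S * R"
    and AR: "A * R = R * B" and SA: "S * A = B * S"
    using assms by (auto simp: shift_equivalent_def)
  \<comment> \<open>Well-definedness, stated once for both maps; \<open>d\<close> is the number of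
    copies by which the index is raised.\<close>
  have induced: "(\<Union>(w, j)\<in>dirlim_class C v k. dirlim_class D (w \<^sub>v* Q) (j + d)) = dirlim_class D (v \<^sub>v* Q) (k + d)"
    if C: "C \<in> carrier_mat a a" and D: "D \<in> carrier_mat b b" and Q: "Q \<in> carrier_mat a b"
      and CQ: "C * Q = Q * D" and v: "v \<in> carrier_vec a"
    for C D Q :: "'a mat" and a b v k d
  proof (rule UN_dirlim_class[OF C v, where f = "\<lambda>w j. dirlim_class D (w \<^sub>v* Q) (j + d)"])
    fix w j p q
    assume "w \<in> carrier_vec a" "k + p = j + q" "row_iterate C p v = row_iterate C q w"
    then show "dirlim_class D (w \<^sub>v* Q) (j + d) = dirlim_class D (v \<^sub>v* Q) (k + d)"
      using v Q row_iterate_intertwine[OF C D Q CQ]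
      by (intro dirlim_class_eqI[OF D, where p = q and q = p]) (simp_all, metis)
  qed
  define f where "f X = (\<Union>(w, j)\<in>X. dirlim_class B (w \<^sub>v* R) (j + 0))" for X
  \<comment> \<open>The index rises by \<open>l\<close> to compensate for vRS = vA^l, because
    [(vA^l, k + l)] = [(v, k)].\<close>
  define g where "g X = (\<Union>(w, j)\<in>X. dirlim_class A (w \<^sub>v* S) (j + l))" for X
  have f_class: "f (dirlim_class A v k) = dirlim_class B (v \<^sub>v* R) k" if "v \<in> carrier_vec n" for v k
    unfolding f_def using induced[OF A B R AR that, where k = k and d = 0] by simp
  have g_class: "g (dirlim_class B v k) = dirlim_class A (v \<^sub>v* S) (k + l)" if "v \<in> carrier_vec m" for v k
    unfolding g_def by (rule induced[OF B A S SA[symmetric] that])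
  have "bij_betw f (carrier (dirlim A)) (carrier (dirlim B))"
  proof (rule bij_betw_byWitness[where f' = g])
    show "\<forall>X\<in>carrier (dirlim A). g (f X) = X" "\<forall>Y\<in>carrier (dirlim B). f (g Y) = Y"
      using R S by (auto elim!: dirlim_carrierE[OF A] dirlim_carrierE[OF B]
          simp: f_class g_class vec_mult_mat_assoc[of _ n m _ n] vec_mult_mat_assoc[of _ m n _ m]
          RS[symmetric] SR[symmetric] dirlim_class_shift_mat_power[OF A] dirlim_class_shift_mat_power[OF B])
    show "f ` carrier (dirlim A) \<subseteq> carrier (dirlim B)" "g ` carrier (dirlim B) \<subseteq> carrier (dirlim A)"
      using R S by (auto elim!: dirlim_carrierE[OF A] dirlim_carrierE[OF B]
          simp: f_class g_class dirlim_class_closed[OF A] dirlim_class_closed[OF B])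
  qed
  then have "f \<in> module_iso (dirlim A) (dirlim B)"
  proof (rule module_isoI)
    fix X Y assume "X \<in> carrier (dirlim A)" "Y \<in> carrier (dirlim A)"
    then obtain v k w j where "v \<in> carrier_vec n" "X = dirlim_class A v k"
      "w \<in> carrier_vec n" "Y = dirlim_class A w j"
      by (meson dirlim_carrierE[OF A])
    then show "f (X \<oplus>\<^bsub>dirlim A\<^esub> Y) = f X \<oplus>\<^bsub>dirlim B\<^esub> f Y"
      using A B R by (simp add: f_class dirlim_add[OF A] dirlim_add[OF B] vec_mult_mat_add[of _ n m]
          row_iterate_intertwine[OF A B R AR])
  next
    fix X r assume "X \<in> carrier (dirlim A)"
    then show "f (r \<odot>\<^bsub>dirlim A\<^esub> X) = r \<odot>\<^bsub>dirlim B\<^esub> f X"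
      using R by (auto elim!: dirlim_carrierE[OF A]
          simp: f_class dirlim_smult[OF A] dirlim_smult[OF B] vec_mult_mat_smult[of _ n m])
  qed
  then have "f \<in> equivariant_iso (dirlim A) (dirlim_hat_inv A) (dirlim B) (dirlim_hat_inv B)"
    using R by (auto simp: equivariant_iso_def f_class dirlim_hat_inv_class[OF A] dirlim_hat_inv_class[OF B]
        elim!: dirlim_carrierE[OF A])
  then show ?thesis
    by blast
qed

text \<open>With \<open>R\<close> and \<open>S\<close> the matrices of \<open>f\<close> and its
  inverse, the lag is \<open>k + l + p\<close>: the shifts \<open>k\<close> and \<open>l\<close> of
  the two maps, and \<open>p\<close> further steps that turn equality of classes into equality of
  matrices.\<close>

lemma equivariant_iso_imp_shift_equivalent:
  fixes A B :: "'a::{ring, monoid_mult} mat"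
  assumes A: "A \<in> carrier_mat n n" and B: "B \<in> carrier_mat m m"
    and f: "f \<in> equivariant_iso (dirlim A) (dirlim_hat_inv A) (dirlim B) (dirlim_hat_inv B)"
  shows "shift_equivalent A B"
proof -
  interpret A: module_automorphism "dirlim A" "dirlim_hat_inv A" "dirlim_hat A"
    by (rule module_automorphism_dirlim[OF A])
  define g where "g = inv_into (carrier (dirlim A)) f"
  have g: "g \<in> equivariant_iso (dirlim B) (dirlim_hat_inv B) (dirlim A) (dirlim_hat_inv A)"
    unfolding g_def by (rule equivariant_iso_inv_into[OF A.left_module_axioms _ f]) simp
  have bij: "bij_betw f (carrier (dirlim A)) (carrier (dirlim B))"
    using f by (simp add: equivariant_iso_def module_iso_def)
  obtain R k where R: "R \<in> carrier_mat n m" and AR: "A * R = R * B"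
    and fR: "\<And>v j. v \<in> carrier_vec n \<Longrightarrow> f (dirlim_class A v j) = dirlim_class B (v \<^sub>v* R) (k + j)"
    using dirlim_iso_is_matrix[OF A B f] by blast
  obtain S l where S: "S \<in> carrier_mat m n" and BS: "B * S = S * A"
    and gS: "\<And>v j. v \<in> carrier_vec m \<Longrightarrow> g (dirlim_class B v j) = dirlim_class A (v \<^sub>v* S) (l + j)"
    using dirlim_iso_is_matrix[OF B A g] by blast
  have RS: "R * S \<in> carrier_mat n n" and SR: "S * R \<in> carrier_mat m m"
    using R S by auto
  \<comment> \<open>The composite of the two maps sends [(v, 0)] to [(vRS, k + l)], which must equal
    [(v, 0)] = [(vA^d, d)] with d = k + l.\<close>
  let ?d = "k + l"
  have "dirlim_class A (v \<^sub>v* (R * S)) ?d = dirlim_class A (v \<^sub>v* mat_power A ?d) ?d"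
    if v: "v \<in> carrier_vec n" for v
  proof -
    have "dirlim_class A (v \<^sub>v* (R * S)) ?d = g (f (dirlim_class A v 0))"
      using v R S by (simp add: fR gS vec_mult_mat_assoc[of _ n m _ n] add.commute)
    also have "\<dots> = dirlim_class A v 0"
      unfolding g_def using v by (intro inv_into_carrier_eq[OF bij] dirlim_class_closed[OF A]) simp_all
    finally show ?thesis
      using dirlim_class_shift_mat_power[OF A v, of ?d 0] by simp
  qed
  from dirlim_class_mat_eqD[OF A RS _ this]
  have evA: "eventually (\<lambda>p. R * S * mat_power A p = mat_power A ?d * mat_power A p) sequentially"
    using A by simp
  have "dirlim_class B (v \<^sub>v* (S * R)) ?d = dirlim_class B (v \<^sub>v* mat_power B ?d) ?d"
    if v: "v \<in> carrier_vec m" for v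
  proof -
    have "dirlim_class B (v \<^sub>v* (S * R)) ?d = f (g (dirlim_class B v 0))"
      using v R S by (simp add: fR gS vec_mult_mat_assoc[of _ m n _ m])
    also have "\<dots> = dirlim_class B v 0"
      unfolding g_def using v by (intro inv_into_carrier[OF bij] dirlim_class_closed[OF B])
    finally show ?thesis
      using dirlim_class_shift_mat_power[OF B v, of ?d 0] by simp
  qed
  from dirlim_class_mat_eqD[OF B SR _ this]
  have evB: "eventually (\<lambda>p. S * R * mat_power B p = mat_power B ?d * mat_power B p) sequentially"
    using B by simp
  \<comment> \<open>One \<open>p\<close> serves both equations; taking it positive keeps the lag
    positive even if \<open>k = l = 0\<close>.\<close>
  obtain p where p: "p > 0" and pA: "R * S * mat_power A p = mat_power A (?d + p)"
    and pB: "S * R * mat_power B p = mat_power B (?d + p)"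
    using eventually_happens[OF eventually_conj[OF eventually_gt_at_top[of 0] eventually_conj[OF evA evB]]]
    by (auto simp: mat_power_add[OF A] mat_power_add[OF B])
  \<comment> \<open>The surplus power is absorbed into \<open>S\<close> alone, so that AR = RB stays
    untouched.\<close>
  let ?S = "S * mat_power A p"
  have S': "?S \<in> carrier_mat m n"
    using S A by (simp add: mult_carrier_mat[of _ m n])
  \<comment> \<open>Intertwining moves A^p past \<open>R\<close> as B^p, after which
    \<open>pB\<close> applies.\<close>
  have "?S * R = S * (R * mat_power B p)"
    using mat_power_intertwine[OF A B R AR, of p] A R S by (simp add: assoc_mult_mat[of _ m n _ n _ m])
  then have "mat_power B (?d + p) = ?S * R"
    using pB B R S by (simp add: assoc_mult_mat[of _ m n _ m _ m])
  moreover have "mat_power A (?d + p) = R * ?S"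
    using pA A R S by (simp add: assoc_mult_mat[of _ n m _ n _ n])
  moreover have "?S * A = B * ?S"
  proof -
    have "?S * A = S * (A * mat_power A p)"
      using mat_power_intertwine[OF A A A refl, of p] A S by (simp add: assoc_mult_mat[of _ m n _ n _ n])
    also have "\<dots> = B * ?S"
      using A B S by (simp add: BS assoc_mult_mat[of _ m n _ n _ n, symmetric] assoc_mult_mat[of _ m m _ n _ n, symmetric])
    finally show ?thesis .
  qed
  ultimately show ?thesis
    unfolding shift_equivalent_def using p R S' AR A B
    by (intro exI[of _ "?d + p"] conjI bexI[of _ R] bexI[of _ ?S]) simp_all
qed

section \<open>Cokernels and direct limits\<close>

abbreviation monomial_vec :: "nat \<Rightarrow> 'a::zero vec \<Rightarrow> (nat \<Rightarrow>\<^sub>0 'a) vec" where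
  "monomial_vec k \<equiv> map_vec (Poly_Mapping.single k)"

abbreviation coeff_vec :: "nat \<Rightarrow> (nat \<Rightarrow>\<^sub>0 'a::zero) vec \<Rightarrow> 'a vec" where
  "coeff_vec k \<equiv> map_vec (\<lambda>p. Poly_Mapping.lookup p k)"

lemma lookup_mult_single_0:
  fixes p :: "nat \<Rightarrow>\<^sub>0 'a::ring"
  shows "Poly_Mapping.lookup (p * Poly_Mapping.single 0 a) k = Poly_Mapping.lookup p k * a"
  by (induction p rule: poly_mapping_additive_induct)
    (simp_all add: mult_single lookup_single when_def lookup_add distrib_right)

lemma lookup_single_1_mult:
  fixes p :: "nat \<Rightarrow>\<^sub>0 'a::{ring, monoid_mult}"
  shows "Poly_Mapping.lookup (Poly_Mapping.single 1 1 * p) k =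
    (case k of 0 \<Rightarrow> 0 | Suc j \<Rightarrow> Poly_Mapping.lookup p j)"
  by (induction p rule: poly_mapping_additive_induct)
    (auto simp: mult_single lookup_single when_def lookup_add distrib_left split: nat.split)

lemma coeff_vec_mult_mat:
  fixes A :: "'a::ring mat"
  assumes A: "A \<in> carrier_mat n m" and u: "u \<in> carrier_vec n"
  shows "coeff_vec k (u \<^sub>v* map_mat (Poly_Mapping.single 0) A) = coeff_vec k u \<^sub>v* A"
proof (rule eq_vecI)
  have C: "map_mat (Poly_Mapping.single 0) A \<in> carrier_mat n m"
    using A by simp
  fix j assume "j < dim_vec (coeff_vec k u \<^sub>v* A)"
  then have j: "j < m"
    using A by simp
  then show "coeff_vec k (u \<^sub>v* map_mat (Poly_Mapping.single 0) A) $ j = (coeff_vec k u \<^sub>v* A) $ j"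
    using A u by (simp add: vec_mult_mat_index[OF A j] vec_mult_mat_index[OF C j] lookup_sum
        lookup_mult_single_0)
qed simp

lemma monomial_vec_mult_mat:
  fixes A :: "'a::ring mat"
  assumes A: "A \<in> carrier_mat n m" and v: "v \<in> carrier_vec n"
  shows "monomial_vec k v \<^sub>v* map_mat (Poly_Mapping.single 0) A = monomial_vec k (v \<^sub>v* A)"
proof (rule eq_vecI)
  have C: "map_mat (Poly_Mapping.single 0) A \<in> carrier_mat n m"
    using A by simp
  have single_sum: "Poly_Mapping.single k (\<Sum>i<d. g i) = (\<Sum>i<d. Poly_Mapping.single k (g i))"
    for d and g :: "nat \<Rightarrow> 'a"
    by (induction d) (simp_all add: single_add)
  fix j assume "j < dim_vec (monomial_vec k (v \<^sub>v* A))"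
  then have j: "j < m"
    using A by simp
  then show "(monomial_vec k v \<^sub>v* map_mat (Poly_Mapping.single 0) A) $ j =
      monomial_vec k (v \<^sub>v* A) $ j"
    using A v by (simp add: vec_mult_mat_index[OF A j] vec_mult_mat_index[OF C j] single_sum mult_single)
qed simp

lemma smult_monomial_vec:
  fixes v :: "'a::{ring, monoid_mult} vec"
  shows "Poly_Mapping.single j r \<cdot>\<^sub>v monomial_vec k v = monomial_vec (j + k) (r \<cdot>\<^sub>v v)"
  by (rule eq_vecI) (simp_all add: mult_single)

lemma monomial_vec_add:
  "v \<in> carrier_vec n \<Longrightarrow> w \<in> carrier_vec n \<Longrightarrow>
    monomial_vec k (v + w) = monomial_vec k v + monomial_vec k w"
  by (rule eq_vecI) (simp_all add: single_add)

lemma monomial_vec_minus: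
  fixes v w :: "'a::ring vec"
  shows "v \<in> carrier_vec n \<Longrightarrow> w \<in> carrier_vec n \<Longrightarrow>
    monomial_vec k (v - w) = monomial_vec k v - monomial_vec k w"
  by (rule eq_vecI) (simp_all add: single_diff)

lemma coeff_vec_monomial_vec:
  "v \<in> carrier_vec n \<Longrightarrow> coeff_vec j (monomial_vec k v) = (if j = k then v else 0\<^sub>v n)"
  by (rule eq_vecI) (auto simp: lookup_single)

text \<open>Finitely many entries of finite support have a common degree bound.\<close>

lemma coeff_vec_eventually_zero:
  assumes u: "u \<in> carrier_vec n"
  obtains d where "\<And>k. k \<ge> d \<Longrightarrow> coeff_vec k u = 0\<^sub>v n"
proof -
  have "finite (\<Union>i<n. Poly_Mapping.keys (u $ i))"
    by simp
  then obtain d where d: "\<forall>k\<in>\<Union>i<n. Poly_Mapping.keys (u $ i). k < d"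
    unfolding finite_nat_set_iff_bounded by blast
  have "coeff_vec k u = 0\<^sub>v n" if k: "k \<ge> d" for k
  proof (rule eq_vecI)
    fix i assume "i < dim_vec (0\<^sub>v n :: 'a vec)"
    then have i: "i < n"
      by simp
    then have "k \<notin> Poly_Mapping.keys (u $ i)"
      using d k by (meson UN_I leD lessThan_iff)
    then show "coeff_vec k u $ i = 0\<^sub>v n $ i"
      using i u by (simp add: not_in_keys_iff_lookup_eq_zero)
  qed (use u in simp)
  then show ?thesis
    by (rule that)
qed

lemma row_iterate_minus:
  fixes A :: "'a::ring mat"
  assumes A: "A \<in> carrier_mat n n" and v: "v \<in> carrier_vec n" and w: "w \<in> carrier_vec n"
  shows "row_iterate A p (v - w) = row_iterate A p v - row_iterate A p w"
proof (induction p)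
  case (Suc p)
  have "(x - y) \<^sub>v* A = x \<^sub>v* A - y \<^sub>v* A" if "x \<in> carrier_vec n" "y \<in> carrier_vec n" for x y
    using that A
    by (intro eq_vecI) (auto simp: vec_mult_mat_index[OF A] left_diff_distrib sum_subtractf)
  then show ?case
    using Suc A v w by simp
qed simp

context
  fixes A :: "'a::{ring, monoid_mult} mat" and n :: nat
  assumes A: "A \<in> carrier_mat n n"
begin

private abbreviation "F \<equiv> free_module n :: (nat \<Rightarrow>\<^sub>0 'a, (nat \<Rightarrow>\<^sub>0 'a) vec) module"
private abbreviation "cls v \<equiv> cok_image A +>\<^bsub>F\<^esub> v"

interpretation submodule_of "Poly_Mapping.single 0 1" F "cok_image A"
  by (rule submodule_of_cok_image[OF A])

private lemma cok_poly_eq: "cok_poly A = quotient_module F (cok_image A)"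
  using A by (simp add: cok_poly_def)

private lemma cls_eq_iff:
  "u \<in> carrier_vec n \<Longrightarrow> w \<in> carrier_vec n \<Longrightarrow> cls u = cls w \<longleftrightarrow> u - w \<in> cok_image A"
  using coset_eq_iff[of u w] by (simp add: free_module_minus)

text \<open>The key to injectivity: if x t^e = u(I - tA), the coefficients of \<open>u\<close> obey
  a recursion that forces the values x A^p from degree \<open>e\<close> on, whereas \<open>u\<close>
  has finite degree.\<close>

lemma monomial_vec_in_cok_image:
  assumes x: "x \<in> carrier_vec n" and "monomial_vec e x \<in> cok_image A"
  obtains p where "row_iterate A p x = 0\<^sub>v n"
proof -
  let ?C = "map_mat (Poly_Mapping.single 0) A :: (nat \<Rightarrow>\<^sub>0 'a) mat"
  obtain u where u: "u \<in> carrier_vec n" and "monomial_vec e x = u \<^sub>v* I_minus_tA A"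
    using assms A by (auto simp: cok_image_def)
  then have eq: "monomial_vec e x = u - Poly_Mapping.single 1 1 \<cdot>\<^sub>v (u \<^sub>v* ?C)"
    using vec_mult_I_minus_tA[OF A u] by simp
  \<comment> \<open>Comparison of the coefficients of t^k in u = x t^e + t(uA); in degree 0 the last
    summand contributes nothing.\<close>
  have rec: "coeff_vec k u = coeff_vec k (monomial_vec e x) +
      (case k of 0 \<Rightarrow> 0\<^sub>v n | Suc j \<Rightarrow> coeff_vec j u \<^sub>v* A)" for k
  proof (rule eq_vecI)
    fix i assume "i < dim_vec (coeff_vec k (monomial_vec e x) +
      (case k of 0 \<Rightarrow> 0\<^sub>v n | Suc j \<Rightarrow> coeff_vec j u \<^sub>v* A))"
    then have i: "i < n"
      using A by (simp split: nat.splits)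
    have "Poly_Mapping.lookup ((u \<^sub>v* ?C) $ i) j = (coeff_vec j u \<^sub>v* A) $ i" for j
      using coeff_vec_mult_mat[OF A u, of j] i A by (metis index_map_vec(1) dim_vec_mult_mat index_map_mat(3) carrier_matD(2))
    moreover have "Poly_Mapping.lookup (monomial_vec e x $ i) k =
        Poly_Mapping.lookup ((u - Poly_Mapping.single 1 1 \<cdot>\<^sub>v (u \<^sub>v* ?C)) $ i) k"
      by (simp only: eq)
    ultimately show "coeff_vec k u $ i = (coeff_vec k (monomial_vec e x) +
      (case k of 0 \<Rightarrow> 0\<^sub>v n | Suc j \<Rightarrow> coeff_vec j u \<^sub>v* A)) $ i"
      using i u x A by (simp add: lookup_minus lookup_single_1_mult split: nat.splits del: One_nat_def)
  qed (use u x A in \<open>simp split: nat.splits\<close>)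
  have below: "coeff_vec k u = 0\<^sub>v n" if "k < e" for k
    using that
  proof (induction k)
    case (Suc k)
    then show ?case
      using rec[of "Suc k"] x by (simp add: coeff_vec_monomial_vec vec_mult_mat_zero[OF A])
  qed (use rec[of 0] x in \<open>simp add: coeff_vec_monomial_vec\<close>)
  have from_e: "coeff_vec (p + e) u = row_iterate A p x" for p
  proof (induction p)
    case 0
    show ?case
    proof (cases e)
      case 0
      then show ?thesis
        using rec[of e] x by (simp add: coeff_vec_monomial_vec)
    next
      case (Suc j)
      then show ?thesis
        using rec[of e] x below[of j] by (simp add: coeff_vec_monomial_vec vec_mult_mat_zero[OF A])
    qed
  next
    case (Suc p)
    then show ?case
      using rec[of "Suc p + e"] x A by (simp add: coeff_vec_monomial_vec)
  qed
  obtain d where "\<And>k. k \<ge> d \<Longrightarrow> coeff_vec k u = 0\<^sub>v n"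
    using coeff_vec_eventually_zero[OF u] by blast
  \<comment> \<open>Index \<open>d + e\<close> lies beyond the degree bound
    \<open>d\<close>.\<close>
  then have "row_iterate A d x = 0\<^sub>v n"
    using from_e[of d] by simp
  then show ?thesis
    by (rule that)
qed

text \<open>For w = vA^p, the difference w t^(k+p) - wA t^(k+p+1) equals (w t^(k+p))(I - tA). In the
  cokernel this mirrors the identification [(v, k)] = [(vA, k + 1)].\<close>

lemma coset_monomial_vec_shift:
  assumes v: "v \<in> carrier_vec n"
  shows "cls (monomial_vec (k + p) (row_iterate A p v)) = cls (monomial_vec k v)"
proof (induction p)
  case (Suc p)
  let ?w = "row_iterate A p v"
  have w: "?w \<in> carrier_vec n"
    using A v by simp
  have "monomial_vec (k + p) ?w - monomial_vec (Suc (k + p)) (?w \<^sub>v* A) =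
      monomial_vec (k + p) ?w \<^sub>v* I_minus_tA A"
    using w vec_mult_I_minus_tA[OF A, of "monomial_vec (k + p) ?w"]
    by (simp add: monomial_vec_mult_mat[OF A w] smult_monomial_vec)
      (simp add: smult_vec_def vec_eq_iff)
  also have "\<dots> \<in> cok_image A"
    unfolding cok_image_def using w A by (intro imageI) simp
  finally have "cls (monomial_vec (k + p) ?w) = cls (monomial_vec (Suc (k + p)) (?w \<^sub>v* A))"
    using w A by (subst cls_eq_iff) simp_all
  then show ?case
    using Suc by simp
qed simp

text \<open>One direction makes [(v, k)] |-> [v t^k] well defined, the other makes it
  injective.\<close>

lemma coset_monomial_vec_eq_iff:
  assumes v: "v \<in> carrier_vec n" and w: "w \<in> carrier_vec n"
  shows "cls (monomial_vec k v) = cls (monomial_vec j w) \<longleftrightarrow> dirlim_class A v k = dirlim_class A w j"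
proof
  assume "dirlim_class A v k = dirlim_class A w j"
  then obtain p q where "k + p = j + q" "row_iterate A p v = row_iterate A q w"
    by (auto simp: dirlim_class_eq_iff[OF A v w])
  then show "cls (monomial_vec k v) = cls (monomial_vec j w)"
    using coset_monomial_vec_shift[OF v, of k p] coset_monomial_vec_shift[OF w, of j q] by simp
next
  \<comment> \<open>Both monomials are moved to degree \<open>k + j\<close>, so that their
    difference is again a monomial.\<close>
  let ?x = "row_iterate A j v" and ?y = "row_iterate A k w"
  have x: "?x \<in> carrier_vec n" and y: "?y \<in> carrier_vec n"
    using A v w by simp_all
  assume "cls (monomial_vec k v) = cls (monomial_vec j w)"
  then have "cls (monomial_vec (k + j) ?x) = cls (monomial_vec (k + j) ?y)"
    using coset_monomial_vec_shift[OF v, of k j] coset_monomial_vec_shift[OF w, of j k]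
    by (simp add: add.commute)
  then have "monomial_vec (k + j) (?x - ?y) \<in> cok_image A"
    using x y by (simp add: cls_eq_iff monomial_vec_minus[OF x y])
  then obtain p where "row_iterate A p (?x - ?y) = 0\<^sub>v n"
    using monomial_vec_in_cok_image[of "?x - ?y"] x y by auto
  then have zero: "row_iterate A p ?x - row_iterate A p ?y = 0\<^sub>v n"
    by (simp only: row_iterate_minus[OF A x y])
  have "row_iterate A p ?x = row_iterate A p ?y"
  proof (rule eq_vecI)
    fix i assume "i < dim_vec (row_iterate A p ?y)"
    then have i: "i < n"
      using row_iterate_closed[OF A y, of p] by simp
    have "(row_iterate A p ?x - row_iterate A p ?y) $ i = 0"
      unfolding zero using i by simp
    then show "row_iterate A p ?x $ i = row_iterate A p ?y $ i"
      using i row_iterate_closed[OF A y, of p] by simp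
  qed (use row_iterate_closed[OF A x, of p] row_iterate_closed[OF A y, of p] in simp)
  then have "row_iterate A (p + j) v = row_iterate A (p + k) w"
    by (simp only: row_iterate_row_iterate)
  then show "dirlim_class A v k = dirlim_class A w j"
    by (intro dirlim_class_eqI[OF A v w, where p = "p + j" and q = "p + k"]) simp_all
qed

lemma coset_monomial_vec_add:
  assumes v: "v \<in> carrier_vec n" and w: "w \<in> carrier_vec n"
  shows "cls (monomial_vec k v) \<oplus>\<^bsub>cok_poly A\<^esub> cls (monomial_vec j w) =
    cls (monomial_vec (k + j) (row_iterate A j v + row_iterate A k w))"
proof -
  let ?x = "row_iterate A j v" and ?y = "row_iterate A k w"
  have x: "?x \<in> carrier_vec n" and y: "?y \<in> carrier_vec n"
    using A v w by simp_all
  have "cls (monomial_vec k v) \<oplus>\<^bsub>cok_poly A\<^esub> cls (monomial_vec j w) =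
      cls (monomial_vec (k + j) ?x) \<oplus>\<^bsub>cok_poly A\<^esub> cls (monomial_vec (j + k) ?y)"
    by (simp only: coset_monomial_vec_shift[OF v] coset_monomial_vec_shift[OF w])
  also have "\<dots> = cls (monomial_vec (k + j) ?x + monomial_vec (k + j) ?y)"
    unfolding cok_poly_eq using x y by (subst quotient_add) (simp_all add: add.commute)
  finally show ?thesis
    by (simp only: monomial_vec_add[OF x y])
qed

text \<open>Surjectivity, by induction on a degree bound: the top coefficient is split off, and the
  sum of two monomial classes is again a monomial class by
  \<open>coset_monomial_vec_add\<close>.\<close>

lemma coset_eq_monomial_vec:
  assumes u: "u \<in> carrier_vec n"
  obtains v k where "v \<in> carrier_vec n" "cls u = cls (monomial_vec k v)"
proof -
  have "\<exists>v k. v \<in> carrier_vec n \<and> cls u = cls (monomial_vec k v)"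
    if "u \<in> carrier_vec n" "\<And>k. k \<ge> d \<Longrightarrow> coeff_vec k u = 0\<^sub>v n" for d u
    using that
  proof (induction d arbitrary: u)
    case 0
    have "Poly_Mapping.lookup (u $ i) k = 0" if "i < n" for i k
      using 0(2)[of k] 0(1) that by (metis index_map_vec(1) carrier_vecD index_zero_vec(1) le0)
    \<comment> \<open>All coefficients vanish; degree 0 is an arbitrary choice.\<close>
    then have "u = monomial_vec 0 (0\<^sub>v n)"
      using 0(1) by (intro eq_vecI poly_mapping_eqI) auto
    then show ?case
      by (metis zero_carrier_vec)
  next
    case (Suc d)
    \<comment> \<open>The vector \<open>u\<close> without its term of degree \<open>d\<close>, so
      that the bound \<open>d\<close> applies to it.\<close>
    define u' where "u' = map_vec (\<lambda>p. p - Poly_Mapping.single d (Poly_Mapping.lookup p d)) u"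
    have u': "u' \<in> carrier_vec n" and z: "coeff_vec d u \<in> carrier_vec n"
      using Suc.prems(1) by (simp_all add: u'_def)
    have "coeff_vec k u' = 0\<^sub>v n" if "k \<ge> d" for k
    proof (cases "k = d")
      case True
      then show ?thesis
        using Suc.prems(1) by (intro eq_vecI) (auto simp: u'_def lookup_minus)
    next
      case False
      then have "coeff_vec k u = 0\<^sub>v n"
        using that Suc.prems(2)[of k] by simp
      moreover have "coeff_vec k u' = coeff_vec k u"
        using False by (intro eq_vecI) (auto simp: u'_def lookup_minus lookup_single)
      ultimately show ?thesis
        by simp
    qed
    then obtain v k where v: "v \<in> carrier_vec n" "cls u' = cls (monomial_vec k v)"
      using Suc.IH[OF u'] by blast
    have "u = u' + monomial_vec d (coeff_vec d u)"
      using Suc.prems(1) by (intro eq_vecI) (simp_all add: u'_def)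
    then have "cls u = cls (u' + monomial_vec d (coeff_vec d u))"
      by (rule arg_cong)
    also have "\<dots> = cls u' \<oplus>\<^bsub>cok_poly A\<^esub> cls (monomial_vec d (coeff_vec d u))"
      unfolding cok_poly_eq using u' z by (subst quotient_add) simp_all
    also have "\<dots> = cls (monomial_vec (k + d) (row_iterate A d v + row_iterate A k (coeff_vec d u)))"
      unfolding v(2) by (rule coset_monomial_vec_add[OF v(1) z])
    finally show ?case
      using add_carrier_vec[OF row_iterate_closed[OF A v(1)] row_iterate_closed[OF A z]] by blast
  qed
  then have "\<exists>v k. v \<in> carrier_vec n \<and> cls u = cls (monomial_vec k v)"
    using coeff_vec_eventually_zero[OF u] u by metis
  then show ?thesis
    using that by blast
qed

lemma equivariant_iso_dirlim_cok:
  "equivariant_iso (dirlim A) (dirlim_hat_inv A)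
    (restrict_scalars (Poly_Mapping.single 0) (cok_poly A)) (cok_t A) \<noteq> {}"
proof -
  define f where "f X = (\<Union>(v, k)\<in>X. cls (monomial_vec k v))" for X
  have f_class: "f (dirlim_class A v k) = cls (monomial_vec k v)" if v: "v \<in> carrier_vec n" for v k
    unfolding f_def
  proof (rule UN_dirlim_class[OF A v, where f = "\<lambda>v k. cls (monomial_vec k v)"])
    fix w j p q
    assume w: "w \<in> carrier_vec n" "k + p = j + q" "row_iterate A p v = row_iterate A q w"
    then show "cls (monomial_vec j w) = cls (monomial_vec k v)"
      using coset_monomial_vec_eq_iff[OF v w(1)] dirlim_class_eqI[OF A v w] by metis
  qed
  have carr: "carrier (cok_poly A) = cls ` carrier_vec n"
    by (simp add: cok_poly_eq quotient_carrier)
  have "bij_betw f (carrier (dirlim A)) (carrier (cok_poly A))"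
  proof (rule bij_betw_imageI)
    show "inj_on f (carrier (dirlim A))"
      by (auto intro!: inj_onI elim!: dirlim_carrierE[OF A] simp: f_class coset_monomial_vec_eq_iff)
    have "X \<in> f ` carrier (dirlim A)" if X: "X \<in> carrier (cok_poly A)" for X
    proof -
      obtain u where u: "u \<in> carrier_vec n" "X = cls u"
        using X carr by auto
      obtain v k where "v \<in> carrier_vec n" "X = cls (monomial_vec k v)"
        using coset_eq_monomial_vec[OF u(1)] u(2) by metis
      then show ?thesis
        using f_class dirlim_class_closed[OF A] by (metis imageI)
    qed
    then show "f ` carrier (dirlim A) = carrier (cok_poly A)"
      by (auto elim!: dirlim_carrierE[OF A] simp: f_class carr)
  qed
  then have "f \<in> module_iso (dirlim A) (restrict_scalars (Poly_Mapping.single 0) (cok_poly A))"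
  proof (intro module_isoI)
    fix X Y assume "X \<in> carrier (dirlim A)" "Y \<in> carrier (dirlim A)"
    then obtain v k w j where vw: "v \<in> carrier_vec n" "X = dirlim_class A v k"
      "w \<in> carrier_vec n" "Y = dirlim_class A w j"
      by (meson dirlim_carrierE[OF A])
    then have "row_iterate A j v + row_iterate A k w \<in> carrier_vec n"
      using A by simp
    then show "f (X \<oplus>\<^bsub>dirlim A\<^esub> Y) =
        f X \<oplus>\<^bsub>restrict_scalars (Poly_Mapping.single 0) (cok_poly A)\<^esub> f Y"
      using vw by (simp add: dirlim_add[OF A] f_class coset_monomial_vec_add)
  next
    fix X r assume "X \<in> carrier (dirlim A)"
    then obtain v k where "v \<in> carrier_vec n" "X = dirlim_class A v k"
      by (rule dirlim_carrierE[OF A])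
    then show "f (r \<odot>\<^bsub>dirlim A\<^esub> X) =
        r \<odot>\<^bsub>restrict_scalars (Poly_Mapping.single 0) (cok_poly A)\<^esub> f X"
      by (simp add: dirlim_smult[OF A] f_class cok_poly_eq quotient_smult smult_monomial_vec)
  qed simp
  \<comment> \<open>Passing to the next copy corresponds to raising the degree of the monomial by
    one.\<close>
  moreover have "f (dirlim_hat_inv A X) = cok_t A (f X)" if "X \<in> carrier (dirlim A)" for X
  proof -
    obtain v k where v: "v \<in> carrier_vec n" "X = dirlim_class A v k"
      using dirlim_carrierE[OF A \<open>X \<in> carrier (dirlim A)\<close>] .
    have "1 \<cdot>\<^sub>v v = v"
      by (simp add: smult_vec_def vec_eq_iff)
    then have "Poly_Mapping.single 1 1 \<cdot>\<^sub>v monomial_vec k v = monomial_vec (Suc k) v"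
      by (simp add: smult_monomial_vec)
    then show ?thesis
      using v cok_t_coset[OF A, of "monomial_vec k v"] by (simp add: dirlim_hat_inv_class[OF A] f_class)
  qed
  ultimately have "f \<in> equivariant_iso (dirlim A) (dirlim_hat_inv A)
      (restrict_scalars (Poly_Mapping.single 0) (cok_poly A)) (cok_t A)"
    by (simp add: equivariant_iso_def)
  then show ?thesis
    by blast
qed

lemma dirlim_laurent_isomorphic_cok_laurent: "dirlim_laurent A \<cong>\<^sub>m cok_laurent A"
  unfolding dirlim_laurent_def cok_laurent_def
  by (simp add: laurent_isomorphic_iff_equivariant module_automorphism_dirlim[OF A]
      module_automorphism_cok[OF A] equivariant_iso_dirlim_cok)

text \<open>\<open>dirlim_poly\<close> is a restriction of the Laurent module by definition, but
  \<open>cok_poly\<close> is the quotient itself; \<open>cok_laurent_restrict\<close> bridges the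
  gap through the identity map.\<close>

lemma dirlim_poly_isomorphic_cok_poly: "dirlim_poly A \<cong>\<^sub>m cok_poly A"
proof (rule module_isomorphic_trans)
  show "dirlim_poly A \<cong>\<^sub>m restrict_scalars poly_to_laurent (cok_laurent A)"
    unfolding dirlim_poly_def dirlim_laurent_def cok_laurent_def
    by (simp add: poly_isomorphic_iff_equivariant module_automorphism_dirlim[OF A]
        module_automorphism_cok[OF A] equivariant_iso_dirlim_cok)
  have "carrier (cok_laurent A) = carrier (cok_poly A)" "add (cok_laurent A) = add (cok_poly A)"
    by (simp_all add: cok_laurent_def laurent_module_simps)
  then have "id \<in> module_iso (restrict_scalars poly_to_laurent (cok_laurent A)) (cok_poly A)"
    by (intro module_isoI) (simp_all add: cok_laurent_restrict[OF A])
  then show "restrict_scalars poly_to_laurent (cok_laurent A) \<cong>\<^sub>m cok_poly A"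
    by (auto simp: module_isomorphic_def)
qed

end

theorem theorem2p10p1:
  fixes A B :: "'a::{ring, monoid_mult} mat" and n m :: nat
  assumes "A \<in> carrier_mat n n" and "B \<in> carrier_mat m m"
  shows "(cok_poly A \<cong>\<^sub>m dirlim_poly A \<and> cok_laurent A \<cong>\<^sub>m dirlim_laurent A) \<and>
    (shift_equivalent A B \<longleftrightarrow> dirlim_poly A \<cong>\<^sub>m dirlim_poly B) \<and>
    (dirlim_poly A \<cong>\<^sub>m dirlim_poly B \<longleftrightarrow> cok_poly A \<cong>\<^sub>m cok_poly B) \<and>
    (cok_poly A \<cong>\<^sub>m cok_poly B \<longleftrightarrow> dirlim_laurent A \<cong>\<^sub>m dirlim_laurent B) \<and>
    (dirlim_laurent A \<cong>\<^sub>m dirlim_laurent B \<longleftrightarrow> cok_laurent A \<cong>\<^sub>m cok_laurent B)"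
proof -
  note A = assms(1) and B = assms(2)
  \<comment> \<open>The hub of the proof: shift equivalence and both isomorphism conditions on
    direct limits are each equivalent to \<open>?E\<close> being nonempty; the conditions on
    cokernels are reached through \<open>poly\<close> and \<open>laurent\<close>.\<close>
  let ?E = "equivariant_iso (dirlim A) (dirlim_hat_inv A) (dirlim B) (dirlim_hat_inv B)"
  note poly = module_isomorphic_cong[OF left_module_dirlim_poly[OF A] left_module_dirlim_poly[OF B]
      dirlim_poly_isomorphic_cok_poly[OF A] dirlim_poly_isomorphic_cok_poly[OF B]]
  note laurent = module_isomorphic_cong[OF left_module_dirlim_laurent[OF A] left_module_dirlim_laurent[OF B]
      dirlim_laurent_isomorphic_cok_laurent[OF A] dirlim_laurent_isomorphic_cok_laurent[OF B]]
  have "cok_poly A \<cong>\<^sub>m dirlim_poly A" "cok_laurent A \<cong>\<^sub>m dirlim_laurent A"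
    by (rule module_isomorphic_sym[OF left_module_dirlim_poly[OF A] dirlim_poly_isomorphic_cok_poly[OF A]]
        module_isomorphic_sym[OF left_module_dirlim_laurent[OF A] dirlim_laurent_isomorphic_cok_laurent[OF A]])+
  moreover have "shift_equivalent A B \<longleftrightarrow> ?E \<noteq> {}"
    using shift_equivalent_imp_equivariant_iso[OF A B] equivariant_iso_imp_shift_equivalent[OF A B] by blast
  moreover have "dirlim_poly A \<cong>\<^sub>m dirlim_poly B \<longleftrightarrow> ?E \<noteq> {}"
    unfolding dirlim_poly_def dirlim_laurent_def
    by (rule poly_isomorphic_iff_equivariant[OF module_automorphism_dirlim[OF A] module_automorphism_dirlim[OF B]])
  moreover have "dirlim_laurent A \<cong>\<^sub>m dirlim_laurent B \<longleftrightarrow> ?E \<noteq> {}"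
    unfolding dirlim_laurent_def
    by (rule laurent_isomorphic_iff_equivariant[OF module_automorphism_dirlim[OF A] module_automorphism_dirlim[OF B]])
  ultimately show ?thesis
    using poly laurent by simp
qed

end
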